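(* Let $D\subset L^2(T)$ be an identifiable sub-space with $\dim D=d<\infty$, let $E=\pi(D)$ be its orthogonal projection on $S$, and let $\boldsymbol{\widehat\beta^D_n},\boldsymbol{\widehat\beta^E_n}\in\mathbb{R}^d$ be the coordinate vectors (in orthonormal bases of $D$ and $E$ respectively) of the least square estimators $\arg\min_{b\in D}\sum_{i=1}^n(y_i-\langle x_i,b\rangle)^2$ and $\arg\min_{b\in E}\sum_{i=1}^n(y_i-\langle x_i,b\rangle)^2$. Let $P$ be the $d\times d$ matrix, with entries $P_{jk}=\langle\varphi^E_j,\varphi^D_k\rangle$, representing $\pi:D\to E$ in these bases $\{\varphi^D_k\}$ and $\{\varphi^E_k\}$. Conditionally on $\mathbf{x}=(x_1,\dots,x_n)$ for which these estimators are uniquely defined, let $\nu^D_1\ge\dots\ge\nu^D_d$ and $\nu^E_1\ge\dots\ge\nu^E_d$ be the ordered eigenvalues of $\mathrm{Cov}(\boldsymbol{\widehat\beta^D_n}\mid\mathbf{x})$ and $\mathrm{Cov}(\boldsymbol{\widehat\beta^E_n}\mid\mathbf{x})$. Then $$\mathrm{Cov}(\boldsymbol{\widehat\beta^D_n}\mid\mathbf{x})=P^{-1}\,\mathrm{Cov}(\boldsymbol{\widehat\beta^E_n}\mid\mathbf{x})\,(P^{-1})^T,$$ and: (i) $\nu^D_k\ge\nu^E_k$ for every $k=1,\dots,d$; (ii) if $D\subseteq S$, then $\nu^D_k=\nu^E_k$ for every $k=1,\dots,d$; (iii) if all the eigenvalues of $P^TP$ are greater than some $\epsilon_D>0$, then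 $\nu^D_k\le\frac{1}{\epsilon_D}\nu^E_k$ for every $k=1,\dots,d$.
   Context: $T\subset\mathbb{R}$ is compact, $\langle a,b\rangle=\int_T a(t)b(t)\,dt$ is the inner product of $L^2(T)$. The model is $y_i=\langle x_i,\beta\rangle+\epsilon_i$, $i=1,\dots,n$, where $\beta\in L^2(T)$ is deterministic, $x_1,\dots,x_n$ are i.i.d. copies of an $L^2(T)$-valued random element $X$ with $\mathbb{E}[X]=0$ and $\mathbb{E}\|X\|^2<\infty$, and $\epsilon_1,\dots,\epsilon_n$ are mutually independent real random variables, independent of the $x_i$, with $\mathbb{E}[\epsilon_i]=0$ and $\mathrm{Var}[\epsilon_i]=\sigma^2>0$. $S$ is the smallest closed linear sub-space of $L^2(T)$ containing the support of the law of $X$; $S^\perp$ is its orthogonal complement. A linear sub-space $D$ is identifiable if $D\cap S^\perp=\{0\}$. $\pi$ is the restriction to $D$ of the orthogonal projection onto $S$; it is a bijection from $D$ onto $E=\pi(D)$ when $D$ is finite dimensional and identifiable. *)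

theory Defs
  imports "HOL-Probability.Probability"
begin

definition square_integrable :: "(real \<Rightarrow> real) \<Rightarrow> bool" where
  "square_integrable f \<longleftrightarrow> f \<in> borel_measurable lborel \<and> integrable lborel (\<lambda>t. (f t)\<^sup>2)"

lemma square_integrable_measurable: "square_integrable f \<Longrightarrow> f \<in> borel_measurable borel"
  by (simp add: square_integrable_def)

lemma square_integrable_mult:
  assumes "square_integrable f" "square_integrable g"
  shows "integrable lborel (\<lambda>t. f t * g t)"
proof (rule Bochner_Integration.integrable_bound)
  show "integrable lborel (\<lambda>t. (f t)\<^sup>2 + (g t)\<^sup>2)"
    using assms by (auto simp: square_integrable_def)
  show "(\<lambda>t. f t * g t) \<in> borel_measurable lborel"
    using assms by (auto simp: square_integrable_def)
  show "AE t in lborel. norm (f t * g t) \<le> norm ((f t)\<^sup>2 + (g t)\<^sup>2)"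
  proof (rule AE_I2)
    fix t
    have "2 * \<bar>f t\<bar> * \<bar>g t\<bar> \<le> (f t)\<^sup>2 + (g t)\<^sup>2"
      using sum_squares_bound[of "\<bar>f t\<bar>" "\<bar>g t\<bar>"] by simp
    moreover have "0 \<le> \<bar>f t\<bar> * \<bar>g t\<bar>" by simp
    ultimately show "norm (f t * g t) \<le> norm ((f t)\<^sup>2 + (g t)\<^sup>2)"
      unfolding real_norm_def abs_mult by linarith
  qed
qed

lemma square_integrable_zero: "square_integrable (\<lambda>t. 0)"
  by (simp add: square_integrable_def)

lemma square_integrable_scale: "square_integrable f \<Longrightarrow> square_integrable (\<lambda>t. c * f t)"
  by (auto simp: square_integrable_def power_mult_distrib)

lemma square_integrable_add:
  assumes "square_integrable f" "square_integrable g"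
  shows "square_integrable (\<lambda>t. f t + g t)"
proof -
  have "integrable lborel (\<lambda>t. (f t)\<^sup>2 + (g t)\<^sup>2 + 2 * (f t * g t))"
    using assms square_integrable_mult[OF assms] by (auto simp: square_integrable_def)
  then show ?thesis
    using assms by (auto simp: square_integrable_def power2_sum mult.assoc)
qed

text \<open>
  The elements of \<open>l2\<close> are the square-integrable functions on the whole real line modulo equality
  almost everywhere. The domain \<open>T\<close> is a term and cannot parametrise a type, so
  $L^2(T)$ is rendered below as the subspace \<open>L2_on T\<close> of classes vanishing off \<open>T\<close>.
\<close>

definition l2_rel :: "(real \<Rightarrow> real) \<Rightarrow> (real \<Rightarrow> real) \<Rightarrow> bool" where
  "l2_rel f g \<longleftrightarrow> square_integrable f \<and> square_integrable g \<and> (AE t in lborel. f t = g t)"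

lemma l2_rel_measurable:
  "l2_rel f g \<Longrightarrow> f \<in> borel_measurable borel" "l2_rel f g \<Longrightarrow> g \<in> borel_measurable borel"
  by (auto simp: l2_rel_def square_integrable_def)

quotient_type l2 = "real \<Rightarrow> real" / partial: l2_rel
proof (rule part_equivpI)
  show "\<exists>f. l2_rel f f"
    using square_integrable_zero by (auto simp: l2_rel_def)
  show "symp l2_rel"
    by (auto simp: symp_def l2_rel_def elim!: AE_mp)
  show "transp l2_rel"
  proof (rule transpI)
    fix f g h assume a: "l2_rel f g" "l2_rel g h"
    then have "AE t in lborel. f t = g t" "AE t in lborel. g t = h t"
      by (auto simp: l2_rel_def)
    then have "AE t in lborel. f t = h t" by eventually_elim simp
    with a show "l2_rel f h" by (auto simp: l2_rel_def)
  qed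
qed

instantiation l2 :: real_vector
begin

lift_definition zero_l2 :: l2 is "\<lambda>t. 0"
  by (simp add: l2_rel_def square_integrable_zero)

lift_definition plus_l2 :: "l2 \<Rightarrow> l2 \<Rightarrow> l2" is "\<lambda>f g t. f t + g t"
  by (auto simp: l2_rel_def square_integrable_add)

lift_definition scaleR_l2 :: "real \<Rightarrow> l2 \<Rightarrow> l2" is "\<lambda>c f t. c * f t"
  by (auto simp: l2_rel_def square_integrable_scale)

lift_definition uminus_l2 :: "l2 \<Rightarrow> l2" is "\<lambda>f t. - f t"
  by (auto simp: l2_rel_def square_integrable_def)

definition minus_l2 :: "l2 \<Rightarrow> l2 \<Rightarrow> l2" where
  "minus_l2 f g = f + (- g)"

instance
proof
  fix a b c :: l2 and r s :: real
  show "a + b + c = a + (b + c)"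
    by transfer (auto simp: l2_rel_def square_integrable_add add.assoc)
  show "a + b = b + a"
    by transfer (auto simp: l2_rel_def square_integrable_add add.commute)
  show "0 + a = a"
    by transfer (auto simp: l2_rel_def)
  show "- a + a = 0"
    by transfer (auto simp: l2_rel_def square_integrable_zero)
  show "a - b = a + - b"
    by (simp add: minus_l2_def)
  show "r *\<^sub>R (a + b) = r *\<^sub>R a + r *\<^sub>R b"
    by transfer (auto simp: l2_rel_def square_integrable_add square_integrable_scale algebra_simps)
  show "(r + s) *\<^sub>R a = r *\<^sub>R a + s *\<^sub>R a"
    by transfer (auto simp: l2_rel_def square_integrable_add square_integrable_scale
        distrib_right)
  show "r *\<^sub>R s *\<^sub>R a = (r * s) *\<^sub>R a"
    by transfer (auto simp: l2_rel_def square_integrable_scale algebra_simps)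
  show "1 *\<^sub>R a = a"
    by transfer (auto simp: l2_rel_def)
qed

end

instantiation l2 :: real_inner
begin

lift_definition inner_l2 :: "l2 \<Rightarrow> l2 \<Rightarrow> real" is "\<lambda>f g. LINT t|lborel. f t * g t"
proof -
  fix f f' g g' :: "real \<Rightarrow> real"
  assume a: "l2_rel f f'" "l2_rel g g'"
  note [measurable] = l2_rel_measurable[OF a(1)] l2_rel_measurable[OF a(2)]
  from a have "AE t in lborel. f t = f' t" "AE t in lborel. g t = g' t"
    by (auto simp: l2_rel_def)
  then have "AE t in lborel. f t * g t = f' t * g' t" by eventually_elim simp
  then show "(LINT t|lborel. f t * g t) = (LINT t|lborel. f' t * g' t)"
    by (intro integral_cong_AE) auto
qed

definition norm_l2 :: "l2 \<Rightarrow> real" where "norm_l2 f = sqrt (inner f f)"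
definition sgn_l2 :: "l2 \<Rightarrow> l2" where "sgn_l2 f = f /\<^sub>R norm f"
definition dist_l2 :: "l2 \<Rightarrow> l2 \<Rightarrow> real" where "dist_l2 f g = norm (f - g)"
definition uniformity_l2 :: "(l2 \<times> l2) filter" where
  "uniformity_l2 = (INF e\<in>{0<..}. principal {(f, g). dist f g < e})"
definition open_l2 :: "l2 set \<Rightarrow> bool" where
  "open_l2 U \<longleftrightarrow> (\<forall>f\<in>U. eventually (\<lambda>(f', g). f' = f \<longrightarrow> g \<in> U) uniformity)"

instance
proof
  fix a b c :: l2 and r :: real
  show "dist a b = norm (a - b)" "sgn a = a /\<^sub>R norm a" "norm a = sqrt (inner a a)"
    by (simp_all add: dist_l2_def sgn_l2_def norm_l2_def)
  show "(uniformity :: (l2 \<times> l2) filter) = (INF e\<in>{0<..}. principal {(f, g). dist f g < e})"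
    by (simp add: uniformity_l2_def)
  show "open U \<longleftrightarrow> (\<forall>f\<in>U. eventually (\<lambda>(f', g). f' = f \<longrightarrow> g \<in> U) uniformity)" for U :: "l2 set"
    by (simp add: open_l2_def)
  show "inner a b = inner b a"
    by transfer (simp add: mult.commute)
  show "inner (a + b) c = inner a c + inner b c"
    by transfer (simp add: l2_rel_def distrib_right square_integrable_mult)
  show "inner (r *\<^sub>R a) b = r * inner a b"
    by transfer (simp add: mult.assoc)
  show "0 \<le> inner a a"
    by transfer (simp add: integral_nonneg_AE)
  show "inner a a = 0 \<longleftrightarrow> a = 0"
  proof (transfer, safe)
    fix f assume f: "l2_rel f f" and z: "(LINT t|lborel. f t * f t) = 0"
    have "AE t in lborel. f t * f t = 0"
      using f z by (subst integral_nonneg_eq_0_iff_AE[symmetric])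
        (auto simp: l2_rel_def square_integrable_mult)
    then show "l2_rel f (\<lambda>t. 0)"
      using f by (auto simp: l2_rel_def square_integrable_zero)
  next
    fix f :: "real \<Rightarrow> real" assume f: "l2_rel f f" and z: "l2_rel f (\<lambda>t. 0)"
    have "AE t in lborel. f t * f t = 0"
      using z by (auto simp: l2_rel_def)
    then show "(LINT t|lborel. f t * f t) = 0" by (rule integral_eq_zero_AE)
  qed
qed

end

lemma l2_representative:
  "l2_rel (rep_l2 f) (rep_l2 f)" "abs_l2 (rep_l2 f) = f"
  by (rule Quotient_rep_reflp[OF Quotient_l2], rule Quotient_abs_rep[OF Quotient_l2])

lemma inner_abs_l2:
  assumes "square_integrable f" "square_integrable g"
  shows "inner (abs_l2 f) (abs_l2 g) = (LINT t|lborel. f t * g t)"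
  using assms by (intro inner_l2.abs_eq) (auto simp: l2_rel_def)

lemma abs_l2_surj:
  obtains f where "square_integrable f" "x = abs_l2 f"
  using l2_representative[of x] by (auto simp: l2_rel_def)

lemma minus_abs_l2:
  assumes "square_integrable f" "square_integrable g"
  shows "abs_l2 f - abs_l2 g = abs_l2 (\<lambda>t. f t - g t)"
proof -
  have g: "square_integrable (\<lambda>t. - g t)"
    using square_integrable_scale[OF assms(2), of "-1"] by simp
  have "- abs_l2 g = abs_l2 (\<lambda>t. - g t)"
    using assms by (intro uminus_l2.abs_eq) (auto simp: l2_rel_def)
  moreover have "abs_l2 f + abs_l2 (\<lambda>t. - g t) = abs_l2 (\<lambda>t. f t + - g t)"
    using assms g by (intro plus_l2.abs_eq) (auto simp: l2_rel_def)
  ultimately show ?thesis by (simp add: minus_l2_def)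
qed

lemma square_integrable_diff:
  "square_integrable f \<Longrightarrow> square_integrable g \<Longrightarrow> square_integrable (\<lambda>t. f t - g t)"
  using square_integrable_add[of f "\<lambda>t. -1 * g t"] square_integrable_scale[of g "-1"] by simp

lemma norm_abs_l2:
  assumes "square_integrable f"
  shows "ennreal ((norm (abs_l2 f))\<^sup>2) = (\<integral>\<^sup>+t. ennreal ((f t)\<^sup>2) \<partial>lborel)"
  using assms by (simp add: power2_norm_eq_inner inner_abs_l2 nn_integral_eq_integral
      square_integrable_def flip: power2_eq_square)


lemma l2_Cauchy_convergent:
  fixes u :: "nat \<Rightarrow> l2"
  assumes "Cauchy u"
  shows "convergent u"
proof -
  have "\<forall>k. \<exists>N. \<forall>m\<ge>N. \<forall>n\<ge>N. dist (u m) (u n) < (1/4::real)^k"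
    using assms unfolding Cauchy_def by simp
  then obtain N where N: "\<And>k m n. m \<ge> N k \<Longrightarrow> n \<ge> N k \<Longrightarrow> dist (u m) (u n) < (1/4::real)^k"
    by metis
  define r where "r k = Max (N ` {..k})" for k
  have r: "N j \<le> r k" if "j \<le> k" for j k
    unfolding r_def by (rule Max_ge) (use that in simp_all)
  have "\<forall>k. \<exists>f. square_integrable f \<and> u (r k) = abs_l2 f"
    by (metis abs_l2_surj)
  then obtain F where F: "\<And>k. square_integrable (F k)" "\<And>k. u (r k) = abs_l2 (F k)"
    by metis
  have Fm [measurable]: "F k \<in> borel_measurable borel" for k
    using F(1) by (rule square_integrable_measurable)
  define d where "d k t = F (Suc k) t - F k t" for k t
  have d: "square_integrable (d k)" for k
    unfolding d_def by (intro square_integrable_diff F)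
  have dm [measurable]: "d k \<in> borel_measurable borel" for k
    using d by (rule square_integrable_measurable)
  have bd: "(\<integral>\<^sup>+t. ennreal ((d k t)\<^sup>2) \<partial>lborel) \<le> ennreal ((1/16)^k)" for k
  proof -
    have "u (r (Suc k)) - u (r k) = abs_l2 (d k)"
      unfolding F(2) d_def by (intro minus_abs_l2 F)
    moreover have "norm (u (r (Suc k)) - u (r k)) \<le> (1/4)^k"
      using N[OF r[of k "Suc k"] r[of k k]] by (simp add: dist_norm)
    ultimately have "(norm (abs_l2 (d k)))\<^sup>2 \<le> ((1/4)^k)\<^sup>2"
      by (intro power_mono) auto
    also have "((1/4::real)^k)\<^sup>2 = (1/16)^k"
      by (simp add: power2_eq_square flip: power_mult_distrib)
    finally show ?thesis
      unfolding norm_abs_l2[OF d, symmetric] by (rule ennreal_leI)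
  qed
  have "(\<integral>\<^sup>+t. (\<Sum>k. ennreal (4^k * (d k t)\<^sup>2)) \<partial>lborel)
      = (\<Sum>k. \<integral>\<^sup>+t. ennreal (4^k * (d k t)\<^sup>2) \<partial>lborel)"
    by (intro nn_integral_suminf) measurable
  also have "\<dots> = (\<Sum>k. ennreal (4^k) * (\<integral>\<^sup>+t. ennreal ((d k t)\<^sup>2) \<partial>lborel))"
    by (simp add: ennreal_mult nn_integral_cmult)
  also have "\<dots> \<le> (\<Sum>k. ennreal ((1/4)^k))"
  proof (intro suminf_le allI)
    fix k
    have "ennreal (4^k) * (\<integral>\<^sup>+t. ennreal ((d k t)\<^sup>2) \<partial>lborel) \<le> ennreal (4^k) * ennreal ((1/16)^k)"
      by (intro mult_left_mono bd) auto
    also have "\<dots> = ennreal ((1/4)^k)"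
      by (simp add: ennreal_mult[symmetric] power_mult_distrib[symmetric] del: ennreal_power)
    finally show "ennreal (4^k) * (\<integral>\<^sup>+t. ennreal ((d k t)\<^sup>2) \<partial>lborel) \<le> ennreal ((1/4)^k)" .
  qed auto
  also have "\<dots> = ennreal (\<Sum>k. (1/4)^k)"
    by (intro suminf_ennreal2) auto
  also have "\<dots> < \<infinity>" by simp
  finally have AE1: "(\<integral>\<^sup>+t. (\<Sum>k. ennreal (4^k * (d k t)\<^sup>2)) \<partial>lborel) \<noteq> \<infinity>"
    by (rule less_imp_neq)
  have AE2: "(\<lambda>t. \<Sum>k. ennreal (4^k * (d k t)\<^sup>2)) \<in> borel_measurable lborel"
    by (intro borel_measurable_suminf_order) measurable
  have AEfin: "AE t in lborel. (\<Sum>k. ennreal (4^k * (d k t)\<^sup>2)) \<noteq> \<infinity>"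
    by (rule nn_integral_noteq_infinite[OF AE2 AE1])
  have pw: "convergent (\<lambda>k. F k t)" if fin: "(\<Sum>k. ennreal (4^k * (d k t)\<^sup>2)) \<noteq> \<infinity>" for t
  proof -
    define C where "C = enn2real (\<Sum>k. ennreal (4^k * (d k t)\<^sup>2))"
    have C: "C \<ge> 0" "(\<Sum>k. ennreal (4^k * (d k t)\<^sup>2)) = ennreal C"
    proof -
      show "C \<ge> 0" unfolding C_def by (rule enn2real_nonneg)
      show "(\<Sum>k. ennreal (4^k * (d k t)\<^sup>2)) = ennreal C"
        unfolding C_def using fin by (intro ennreal_enn2real[symmetric]) (simp add: less_top)
    qed
    have le: "\<bar>d k t\<bar> \<le> sqrt C * (1/2)^k" for k
    proof -
      have "ennreal (4^k * (d k t)\<^sup>2) = (\<Sum>i\<in>{k}. ennreal (4^i * (d i t)\<^sup>2))" by simp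
      also have "\<dots> \<le> (\<Sum>k. ennreal (4^k * (d k t)\<^sup>2))"
        by (intro sum_le_suminf) auto
      finally have "ennreal (4^k * (d k t)\<^sup>2) \<le> ennreal C" unfolding C(2) .
      then have "4^k * (d k t)\<^sup>2 \<le> C" by (rule ennreal_le_iff[THEN iffD1, OF C(1)])
      moreover have "(2^k * \<bar>d k t\<bar>)\<^sup>2 = 4^k * (d k t)\<^sup>2"
      proof -
        have "((2::real)^k)\<^sup>2 = 4^k" by (simp add: power_even_eq[symmetric] power_mult)
        then show ?thesis by (simp add: power_mult_distrib)
      qed
      ultimately have "2^k * \<bar>d k t\<bar> \<le> sqrt C"
        by (intro real_le_rsqrt) simp
      then show ?thesis by (simp add: power_divide pos_le_divide_eq mult.commute)
    qed
    have "summable (\<lambda>k. sqrt C * (1/2::real)^k)"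
      by (intro summable_mult summable_geometric) simp
    then have "summable (\<lambda>k. d k t)"
      by (rule summable_comparison_test'[where N=0]) (use le in auto)
    then have "convergent (\<lambda>k. \<Sum>i<k. d i t)"
      by (simp add: summable_iff_convergent)
    moreover have "(\<Sum>i<k. d i t) = F k t - F 0 t" for k
      unfolding d_def by (rule sum_lessThan_telescope)
    ultimately have "convergent (\<lambda>k. F k t - F 0 t)" by simp
    then show "convergent (\<lambda>k. F k t)"
      using convergent_add[of "\<lambda>k. F k t - F 0 t" "\<lambda>k. F 0 t"] by (simp add: convergent_const)
  qed
  have convF: "AE t in lborel. convergent (\<lambda>k. F k t)"
    using AEfin by (rule eventually_mono) (rule pw)
  define G where "G t = lim (\<lambda>k. F k t)" for t
  have Gm [measurable]: "G \<in> borel_measurable borel"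
    unfolding G_def by measurable
  have lim: "AE t in lborel. (\<lambda>k. F k t) \<longlonglongrightarrow> G t"
    using convF
    by eventually_elim (simp add: G_def convergent_LIMSEQ_iff)
  have fatou: "(\<integral>\<^sup>+t. ennreal ((g t - G t)\<^sup>2) \<partial>lborel) \<le> ennreal (e\<^sup>2)"
    if g: "square_integrable g" and ev: "eventually (\<lambda>k. norm (abs_l2 g - u (r k)) \<le> e) sequentially"
      and e: "e > 0" for g e
  proof -
    have [measurable]: "g \<in> borel_measurable borel" using g by (rule square_integrable_measurable)
    have "(\<integral>\<^sup>+t. ennreal ((g t - G t)\<^sup>2) \<partial>lborel)
        = (\<integral>\<^sup>+t. liminf (\<lambda>k. ennreal ((g t - F k t)\<^sup>2)) \<partial>lborel)"
    proof (rule nn_integral_cong_AE)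
      show "AE t in lborel. ennreal ((g t - G t)\<^sup>2) = liminf (\<lambda>k. ennreal ((g t - F k t)\<^sup>2))"
        using lim
      proof eventually_elim
        fix t assume "(\<lambda>k. F k t) \<longlonglongrightarrow> G t"
        then have "(\<lambda>k. ennreal ((g t - F k t)\<^sup>2)) \<longlonglongrightarrow> ennreal ((g t - G t)\<^sup>2)"
          by (intro tendsto_ennrealI tendsto_intros)
        then show "ennreal ((g t - G t)\<^sup>2) = liminf (\<lambda>k. ennreal ((g t - F k t)\<^sup>2))"
          by (intro lim_imp_Liminf[symmetric]) auto
      qed
    qed
    also have "\<dots> \<le> liminf (\<lambda>k. \<integral>\<^sup>+t. ennreal ((g t - F k t)\<^sup>2) \<partial>lborel)"
      by (intro nn_integral_liminf) measurable
    also have "\<dots> = liminf (\<lambda>k. ennreal ((norm (abs_l2 g - u (r k)))\<^sup>2))"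
      unfolding F(2) minus_abs_l2[OF g F(1)]
      by (subst norm_abs_l2[OF square_integrable_diff[OF g F(1)]]) simp
    also have "\<dots> \<le> limsup (\<lambda>k. ennreal ((norm (abs_l2 g - u (r k)))\<^sup>2))"
      by (intro Liminf_le_Limsup) auto
    also have "\<dots> \<le> ennreal (e\<^sup>2)"
      using ev by (intro Limsup_bounded)
        (auto elim!: eventually_mono intro!: ennreal_leI power_mono)
    finally show ?thesis .
  qed
  have ev: "eventually (\<lambda>k. norm (u n - u (r k)) \<le> (1/4)^j) sequentially" if "n \<ge> N j" for n j
    using eventually_ge_at_top[of j]
  proof eventually_elim
    fix k assume "j \<le> k"
    then have "dist (u n) (u (r k)) < (1/4)^j" by (intro N that r)
    then show "norm (u n - u (r k)) \<le> (1/4)^j" by (simp add: dist_norm)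
  qed
  have bound: "square_integrable (\<lambda>t. g t - G t)"
    "(\<integral>\<^sup>+t. ennreal ((g t - G t)\<^sup>2) \<partial>lborel) \<le> ennreal (((1/4)^j)\<^sup>2)"
    if g: "square_integrable g" "u n = abs_l2 g" "n \<ge> N j" for g n j
  proof -
    have [measurable]: "g \<in> borel_measurable borel" using g(1) by (rule square_integrable_measurable)
    show le: "(\<integral>\<^sup>+t. ennreal ((g t - G t)\<^sup>2) \<partial>lborel) \<le> ennreal (((1/4)^j)\<^sup>2)"
      using ev[OF g(3)] by (intro fatou g(1)) (auto simp: g(2))
    have "(\<integral>\<^sup>+t. ennreal ((g t - G t)\<^sup>2) \<partial>lborel) < \<infinity>"
      by (rule le_less_trans[OF le]) simp
    then show "square_integrable (\<lambda>t. g t - G t)"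
      by (auto simp: square_integrable_def intro!: integrableI_nonneg)
  qed
  have G: "square_integrable G"
  proof -
    obtain g where g: "square_integrable g" "u (N 0) = abs_l2 g" by (metis abs_l2_surj)
    from square_integrable_diff[OF g(1) bound(1)[OF g, of 0]] show ?thesis by simp
  qed
  have "u \<longlonglongrightarrow> abs_l2 G"
  proof (rule metric_LIMSEQ_I)
    fix e :: real assume "e > 0"
    then obtain j where j: "(1/4::real)^j < e" using real_arch_pow_inv[of e "1/4"] by auto
    have "dist (u n) (abs_l2 G) < e" if "n \<ge> N j" for n
    proof -
      obtain g where g: "square_integrable g" "u n = abs_l2 g" by (metis abs_l2_surj)
      have "u n - abs_l2 G = abs_l2 (\<lambda>t. g t - G t)"
        unfolding g(2) by (intro minus_abs_l2 g G)
      then have "ennreal ((norm (u n - abs_l2 G))\<^sup>2) \<le> ennreal (((1/4)^j)\<^sup>2)"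
        using bound(2)[OF g that] by (simp only: norm_abs_l2[OF bound(1)[OF g that]])
      then have "(norm (u n - abs_l2 G))\<^sup>2 \<le> ((1/4)^j)\<^sup>2"
        by (rule ennreal_le_iff[THEN iffD1, rotated]) simp
      then have "norm (u n - abs_l2 G) \<le> (1/4)^j"
        by (rule power2_le_imp_le) simp
      with j show ?thesis by (simp add: dist_norm)
    qed
    then show "\<exists>no. \<forall>n\<ge>no. dist (u n) (abs_l2 G) < e" by blast
  qed
  then show ?thesis by (auto simp: convergent_def)
qed

instance l2 :: banach
  by standard (rule l2_Cauchy_convergent)


lemma closed_subspace_projection_exists:
  fixes V :: "'a::{real_inner, complete_space} set"
  assumes V: "subspace V" "closed V"
  shows "\<exists>p\<in>V. \<forall>v\<in>V. inner (f - p) v = 0"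
proof -
  define m where "m = Inf ((\<lambda>v. (norm (f - v))\<^sup>2) ` V)"
  have ne: "V \<noteq> {}" using subspace_0[OF V(1)] by auto
  have bdd: "bdd_below ((\<lambda>v. (norm (f - v))\<^sup>2) ` V)" by (rule bdd_belowI[of _ 0]) auto
  have m_le: "m \<le> (norm (f - v))\<^sup>2" if "v \<in> V" for v
    unfolding m_def using bdd that by (intro cInf_lower) auto
  have "\<exists>v\<in>V. (norm (f - v))\<^sup>2 < m + e" if "e > 0" for e
    using cInf_lessD[of "(\<lambda>v. (norm (f - v))\<^sup>2) ` V" "m + e"] ne that by (auto simp: m_def)
  then have "\<forall>n. \<exists>v. v \<in> V \<and> (norm (f - v))\<^sup>2 < m + inverse (real (Suc n))"
    by (metis inverse_positive_iff_positive of_nat_0_less_iff zero_less_Suc)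
  then obtain v where v: "\<And>n. v n \<in> V" "\<And>n. (norm (f - v n))\<^sup>2 < m + inverse (real (Suc n))"
    by metis
  have par: "(norm (a - b))\<^sup>2 \<le> 2 * ((norm (f - a))\<^sup>2 - m) + 2 * ((norm (f - b))\<^sup>2 - m)"
    if "a \<in> V" "b \<in> V" for a b
  proof -
    have "(1/2) *\<^sub>R (a + b) \<in> V" using that V(1) by (simp add: subspace_add subspace_scale)
    then have "m \<le> (norm (f - (1/2) *\<^sub>R (a + b)))\<^sup>2" by (rule m_le)
    moreover have "(norm (a - b))\<^sup>2 + 4 * (norm (f - (1/2) *\<^sub>R (a + b)))\<^sup>2
        = 2 * (norm (f - a))\<^sup>2 + 2 * (norm (f - b))\<^sup>2"
      unfolding power2_norm_eq_inner by (simp add: algebra_simps inner_commute)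
    ultimately show ?thesis by simp
  qed
  have "Cauchy v"
  proof (rule metric_CauchyI)
    fix e :: real assume "e > 0"
    then obtain M where M: "inverse (real (Suc M)) < e\<^sup>2 / 4"
      using reals_Archimedean[of "e\<^sup>2/4"] by auto
    have "dist (v i) (v j) < e" if "i \<ge> M" "j \<ge> M" for i j
    proof -
      have "inverse (real (Suc i)) \<le> inverse (real (Suc M))"
        "inverse (real (Suc j)) \<le> inverse (real (Suc M))"
        using that by (auto intro!: le_imp_inverse_le)
      with par[OF v(1)[of i] v(1)[of j]] v(2)[of i] v(2)[of j] M
      have "(norm (v i - v j))\<^sup>2 < e\<^sup>2" by argo
      then show ?thesis using \<open>e > 0\<close> by (simp add: dist_norm power_less_imp_less_base)
    qed
    then show "\<exists>M. \<forall>i\<ge>M. \<forall>j\<ge>M. dist (v i) (v j) < e" by blast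
  qed
  then obtain p where p: "v \<longlonglongrightarrow> p" using Cauchy_convergent convergent_def by blast
  have pV: "p \<in> V" using closed_sequentially[OF V(2) _ p] v(1) by blast
  have "(\<lambda>n. (norm (f - v n))\<^sup>2) \<longlonglongrightarrow> (norm (f - p))\<^sup>2"
    by (intro tendsto_intros p)
  moreover have "(\<lambda>n. m + inverse (real (Suc n))) \<longlonglongrightarrow> m"
    using tendsto_add[OF tendsto_const LIMSEQ_inverse_real_of_nat, of m] by simp
  ultimately have pm: "(norm (f - p))\<^sup>2 \<le> m"
    by (rule LIMSEQ_le) (use v(2) less_imp_le in blast)
  have "inner (f - p) w = 0" if "w \<in> V" for w
  proof (cases "w = 0")
    case False
    define c where "c = inner (f - p) w / inner w w"
    have ww: "inner w w \<noteq> 0" using False by simp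
    have "p + c *\<^sub>R w \<in> V" using pV that V(1) by (simp add: subspace_add subspace_scale)
    from order_trans[OF pm m_le[OF this]] have "(norm (f - p))\<^sup>2 \<le> (norm ((f - p) - c *\<^sub>R w))\<^sup>2"
      unfolding diff_diff_eq .
    also have "\<dots> = (norm (f - p))\<^sup>2 - 2 * c * inner (f - p) w + c\<^sup>2 * inner w w"
      unfolding power2_norm_eq_inner
      by (simp add: inner_diff_left inner_diff_right inner_commute power2_eq_square algebra_simps)
    also have "c\<^sup>2 * inner w w = c * inner (f - p) w"
      using ww by (simp add: c_def power2_eq_square)
    finally have "c * inner (f - p) w \<le> 0" by simp
    then have "(inner (f - p) w)\<^sup>2 / inner w w \<le> 0" by (simp add: c_def power2_eq_square)
    moreover have "inner w w > 0" using False by simp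
    ultimately have "(inner (f - p) w)\<^sup>2 \<le> 0"
      by (simp add: divide_le_0_iff)
    then show ?thesis by simp
  qed simp
  with pV show ?thesis by blast
qed

lemma span_countable_separable:
  fixes C :: "'a::real_normed_vector set"
  assumes "countable C"
  shows "\<exists>K. countable K \<and> span C \<subseteq> closure K"
proof -
  define K where "K = (\<lambda>xs. sum_list (map (\<lambda>(q, c). real_of_rat q *\<^sub>R c) xs)) ` lists (UNIV \<times> C)"
  have cK: "countable K" unfolding K_def using assms by (intro countable_image) auto
  have K_add: "x + y \<in> K" if xK: "x \<in> K" and yK: "y \<in> K" for x y
  proof -
    obtain xs where "xs \<in> lists (UNIV \<times> C)" "x = sum_list (map (\<lambda>(q, c). real_of_rat q *\<^sub>R c) xs)"
      using xK unfolding K_def by (elim imageE) blast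
    moreover obtain ys where "ys \<in> lists (UNIV \<times> C)" "y = sum_list (map (\<lambda>(q, c). real_of_rat q *\<^sub>R c) ys)"
      using yK unfolding K_def by (elim imageE) blast
    ultimately show ?thesis unfolding K_def by (intro image_eqI[of _ _ "xs @ ys"]) auto
  qed
  have K_scale: "real_of_rat q *\<^sub>R x \<in> K" if xK: "x \<in> K" for q x
  proof -
    obtain xs where xs: "xs \<in> lists (UNIV \<times> C)" "x = sum_list (map (\<lambda>(q, c). real_of_rat q *\<^sub>R c) xs)"
      using xK unfolding K_def by (elim imageE) blast
    have "real_of_rat q *\<^sub>R sum_list (map (\<lambda>(q, c). real_of_rat q *\<^sub>R c) ys)
      = sum_list (map (\<lambda>(q, c). real_of_rat q *\<^sub>R c) (map (\<lambda>(p, c). (q * p, c)) ys))"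
      for ys :: "(rat \<times> 'a) list"
      by (induction ys) (auto simp: scaleR_add_right of_rat_mult)
    moreover have "map (\<lambda>(p, c). (q * p, c)) xs \<in> lists (UNIV \<times> C)" using xs(1) by auto
    ultimately show ?thesis unfolding K_def xs(2) by (intro image_eqI)
  qed
  have "subspace (closure K)"
    unfolding subspace_def
  proof (intro conjI ballI allI)
    have "sum_list (map (\<lambda>(q, c). real_of_rat q *\<^sub>R c) []) \<in> K" unfolding K_def by (rule imageI) simp
    then show "0 \<in> closure K" by (intro subsetD[OF closure_subset]) simp
  next
    fix x y assume "x \<in> closure K" "y \<in> closure K"
    then obtain a b where "\<And>n. a n \<in> K" "a \<longlonglongrightarrow> x" "\<And>n. b n \<in> K" "b \<longlonglongrightarrow> y"
      unfolding closure_sequential by blast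
    then show "x + y \<in> closure K"
      unfolding closure_sequential
      by (intro exI[of _ "\<lambda>n. a n + b n"] conjI allI K_add tendsto_add)
  next
    fix c :: real and x assume "x \<in> closure K"
    then obtain a where a: "\<And>n. a n \<in> K" "a \<longlonglongrightarrow> x"
      unfolding closure_sequential by blast
    have "c \<in> closure \<rat>" by (simp add: Rats_closure_real)
    then obtain s where s: "\<And>n. s n \<in> \<rat>" "s \<longlonglongrightarrow> c"
      unfolding closure_sequential by blast
    have "s n *\<^sub>R a n \<in> K" for n
    proof -
      obtain q where "s n = real_of_rat q" using s(1)[of n] by (elim Rats_cases)
      then show ?thesis using K_scale[OF a(1)] by simp
    qed
    moreover have "(\<lambda>n. s n *\<^sub>R a n) \<longlonglongrightarrow> c *\<^sub>R x" by (intro tendsto_intros s a)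
    ultimately show "c *\<^sub>R x \<in> closure K"
      unfolding closure_sequential by (intro exI[of _ "\<lambda>n. s n *\<^sub>R a n"] conjI allI)
  qed
  moreover have "C \<subseteq> closure K"
  proof
    fix c assume "c \<in> C"
    then have "sum_list (map (\<lambda>(q, c). real_of_rat q *\<^sub>R c) [(1, c)]) \<in> K"
      unfolding K_def by (intro imageI) auto
    then show "c \<in> closure K" by (intro subsetD[OF closure_subset]) simp
  qed
  ultimately have "span C \<subseteq> closure K" by (rule span_minimal[rotated])
  with cK show ?thesis by blast
qed

lemma separable_imp_countable_subbasis:
  fixes K :: "'a::metric_space set"
  assumes K: "countable K" "closure K = UNIV"
  shows "\<exists>B::'a set set. countable B \<and> open = generate_topology B"
proof -
  define B where "B = (\<lambda>(k, n). ball k (inverse (real (Suc n)))) ` (K \<times> (UNIV::nat set))"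
  have "countable B" unfolding B_def using K(1) by auto
  moreover have "topological_basis B"
  proof (rule topological_basisI)
    show "open U" if "U \<in> B" for U using that by (auto simp: B_def)
  next
    fix U and x :: 'a assume "open U" "x \<in> U"
    then obtain e where e: "e > 0" "ball x e \<subseteq> U" by (meson openE)
    obtain n where n: "inverse (real (Suc n)) < e / 2"
      using reals_Archimedean[of "e / 2"] e(1) by auto
    have "x \<in> closure K" using K(2) by simp
    then obtain k where k: "k \<in> K" "dist k x < inverse (real (Suc n))"
      unfolding closure_approachable by (metis inverse_positive_iff_positive of_nat_0_less_iff zero_less_Suc)
    have "ball k (inverse (real (Suc n))) \<subseteq> ball x e"
    proof
      fix y assume "y \<in> ball k (inverse (real (Suc n)))"
      then show "y \<in> ball x e"
        using k(2) n dist_triangle[of x y k] by (simp add: dist_commute)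
    qed
    with k e show "\<exists>V\<in>B. x \<in> V \<and> V \<subseteq> U"
      by (intro bexI[of _ "ball k (inverse (real (Suc n)))"]) (auto simp: B_def)
  qed
  ultimately show ?thesis using topological_basis_imp_subbasis by blast
qed

lemma AE_zero_if_Ioc_integrals_zero:
  fixes f :: "real \<Rightarrow> real"
  assumes [measurable]: "f \<in> borel_measurable borel"
    and int: "\<And>a b. a \<in> \<rat> \<Longrightarrow> b \<in> \<rat> \<Longrightarrow> integrable lborel (\<lambda>t. indicator {a<..b} t * f t)"
    and zero: "\<And>a b. a \<in> \<rat> \<Longrightarrow> b \<in> \<rat> \<Longrightarrow> (LINT t|lborel. indicator {a<..b} t * f t) = 0"
  shows "AE t in lborel. f t = 0"
proof -
  define E where "E = (\<lambda>(a, b). {a<..b::real}) ` (\<rat> \<times> \<rat>)"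
  have sets: "sets borel = sigma_sets UNIV E"
  proof -
    have "borel = sigma UNIV E"
      unfolding E_def
    proof (rule borel_eq_sigmaI2[where G="\<lambda>a b. {a<..b}" and B=UNIV and F="\<lambda>a b. {a<..b}", OF borel_sigma_sets_Ioc])
      fix a b :: real
      have "{a<..b} = (\<Union>q\<in>{q\<in>\<rat>. a < q}. \<Inter>r\<in>{r\<in>\<rat>. b < r}. {q<..r})"
      proof (intro equalityI subsetI)
        fix t assume t: "t \<in> {a<..b}"
        obtain q where "q \<in> \<rat>" "a < q" "q < t" using Rats_dense_in_real[of a t] t by auto
        with t show "t \<in> (\<Union>q\<in>{q\<in>\<rat>. a < q}. \<Inter>r\<in>{r\<in>\<rat>. b < r}. {q<..r})" by force
      next
        fix t assume "t \<in> (\<Union>q\<in>{q\<in>\<rat>. a < q}. \<Inter>r\<in>{r\<in>\<rat>. b < r}. {q<..r})"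
        then obtain q where q: "q \<in> \<rat>" "a < q" "\<And>r. r \<in> \<rat> \<Longrightarrow> b < r \<Longrightarrow> q < t \<and> t \<le> r" by auto
        have "t \<le> b"
        proof (rule ccontr)
          assume "\<not> t \<le> b"
          then obtain r where "r \<in> \<rat>" "b < r" "r < t" using Rats_dense_in_real[of b t] by auto
          with q(3)[of r] show False by auto
        qed
        moreover obtain r where "r \<in> \<rat>" "b < r" using Rats_dense_in_real[of b "b + 1"] by auto
        ultimately show "t \<in> {a<..b}" using q by force
      qed
      moreover have "(\<Union>q\<in>{q\<in>\<rat>. a < q}. \<Inter>r\<in>{r\<in>\<rat>. b < r}. {q<..r}) \<in>
        sets (sigma UNIV ((\<lambda>(a, b). {a<..b}) ` (\<rat> \<times> \<rat>)))"
      proof -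
        have c: "countable {q\<in>\<rat>. a < (q::real)}" "countable {r\<in>\<rat>. b < (r::real)}"
          using countable_rat by (auto intro: countable_subset[of _ "\<rat>"])
        have "{r\<in>\<rat>. b < (r::real)} \<noteq> {}" using Rats_dense_in_real[of b "b + 1"] by auto
        then show ?thesis
          by (intro sets.countable_UN' sets.countable_INT' c image_subsetI) auto
      qed
      ultimately show "{a<..b} \<in> sets (sigma UNIV ((\<lambda>(a, b). {a<..b}) ` (\<rat> \<times> \<rat>)))" by simp
    qed auto
    then have "sets borel = sets (sigma UNIV E)" by (rule arg_cong)
    then show ?thesis by simp
  qed
  have eq: "density lborel (\<lambda>t. ennreal (f t)) = density lborel (\<lambda>t. ennreal (- f t))"
  proof (rule measure_eqI_generator_eq_countable[where \<Omega>=UNIV and E=E and A=E])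
    show "Int_stable E"
    proof (rule Int_stableI)
      fix U V assume "U \<in> E" "V \<in> E"
      then obtain a b c d where "U = {a<..b}" "V = {c<..d}" "a \<in> \<rat>" "b \<in> \<rat>" "c \<in> \<rat>" "d \<in> \<rat>"
        by (auto simp: E_def)
      then have "U \<inter> V = {max a c<..min b d}" "max a c \<in> \<rat>" "min b d \<in> \<rat>"
        by (auto simp: max_def min_def)
      then show "U \<inter> V \<in> E" unfolding E_def by (intro image_eqI[of _ _ "(max a c, min b d)"]) auto
    qed
    have fin: "(\<integral>\<^sup>+t. ennreal (f t) * indicator U t \<partial>lborel) = (\<integral>\<^sup>+t. ennreal (- f t) * indicator U t \<partial>lborel)
       \<and> (\<integral>\<^sup>+t. ennreal (f t) * indicator U t \<partial>lborel) \<noteq> \<infinity>"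
      if U: "U \<in> E" for U
    proof -
      obtain a b where U: "U = {a<..b}" "a \<in> \<rat>" "b \<in> \<rat>" using U by (auto simp: E_def)
      let ?g = "\<lambda>t. indicator {a<..b} t * f t"
      have i: "integrable lborel ?g" by (rule int[OF U(2,3)])
      have 1: "(\<integral>\<^sup>+t. ennreal (f t) * indicator U t \<partial>lborel) = (\<integral>\<^sup>+t. ennreal (?g t) \<partial>lborel)"
        unfolding U by (intro nn_integral_cong) (auto split: split_indicator)
      have 2: "(\<integral>\<^sup>+t. ennreal (- f t) * indicator U t \<partial>lborel) = (\<integral>\<^sup>+t. ennreal (- ?g t) \<partial>lborel)"
        unfolding U by (intro nn_integral_cong) (auto split: split_indicator)
      have f1: "(\<integral>\<^sup>+t. ennreal (?g t) \<partial>lborel) \<noteq> \<infinity>" "(\<integral>\<^sup>+t. ennreal (- ?g t) \<partial>lborel) \<noteq> \<infinity>"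
        using i unfolding real_integrable_def by auto
      have "enn2real (\<integral>\<^sup>+t. ennreal (?g t) \<partial>lborel) - enn2real (\<integral>\<^sup>+t. ennreal (- ?g t) \<partial>lborel) = 0"
        unfolding real_lebesgue_integral_def[OF i, symmetric] by (rule zero[OF U(2,3)])
      then have "ennreal (enn2real (\<integral>\<^sup>+t. ennreal (?g t) \<partial>lborel))
          = ennreal (enn2real (\<integral>\<^sup>+t. ennreal (- ?g t) \<partial>lborel))"
        by (intro arg_cong[where f=ennreal]) (rule eq_iff_diff_eq_0[THEN iffD2])
      then have "(\<integral>\<^sup>+t. ennreal (?g t) \<partial>lborel) = (\<integral>\<^sup>+t. ennreal (- ?g t) \<partial>lborel)"
        using f1 unfolding infinity_ennreal_def less_top by (simp only: ennreal_enn2real)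
      then show ?thesis unfolding 1 2 using f1(1) by (rule conjI)
    qed
    have Eb: "U \<in> sets borel" if "U \<in> E" for U
      unfolding sets using that by (rule sigma_sets.Basic)
    have em: "emeasure (density lborel (\<lambda>t. ennreal (f t))) U = (\<integral>\<^sup>+t. ennreal (f t) * indicator U t \<partial>lborel)"
      "emeasure (density lborel (\<lambda>t. ennreal (- f t))) U = (\<integral>\<^sup>+t. ennreal (- f t) * indicator U t \<partial>lborel)"
      if "U \<in> E" for U
      using Eb[OF that] by (intro emeasure_density; simp)+
    show "emeasure (density lborel (\<lambda>t. ennreal (f t))) U = emeasure (density lborel (\<lambda>t. ennreal (- f t))) U"
      if "U \<in> E" for U
      unfolding em[OF that] using fin[OF that] by (elim conjE)
    show "emeasure (density lborel (\<lambda>t. ennreal (f t))) U \<noteq> \<infinity>" if "U \<in> E" for U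
      unfolding em[OF that] using fin[OF that] by (elim conjE)
    show "\<Union> E = UNIV"
    proof -
      have "t \<in> \<Union> E" for t
      proof -
        obtain a b where "a \<in> \<rat>" "a < t" "b \<in> \<rat>" "t < b"
          using Rats_dense_in_real[of "t - 1" t] Rats_dense_in_real[of t "t + 1"] by auto
        then show ?thesis unfolding E_def by (intro UnionI[of "{a<..b}"]) auto
      qed
      then show ?thesis by auto
    qed
    show "countable E" unfolding E_def using countable_rat by auto
  qed (use sets in auto)
  have "AE t in lborel. ennreal (f t) = ennreal (- f t)"
    using eq by (subst (asm) sigma_finite_measure.density_unique_iff[OF lborel.sigma_finite_measure_axioms]) auto
  then show ?thesis
    by eventually_elim (metis ennreal_eq_0_iff ennreal_inj linorder_linear neg_0_le_iff_le neg_le_0_iff_le order_antisym)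
qed


definition l2_indicator :: "real \<times> real \<Rightarrow> l2" where
  "l2_indicator = (\<lambda>(a, b). abs_l2 (indicator {a<..b}))"

lemma square_integrable_indicator: "square_integrable (indicator {a<..b::real})"
proof -
  have "(\<lambda>t::real. (indicator {a<..b} t :: real)\<^sup>2) = indicator {a<..b}"
    by (auto simp: fun_eq_iff split: split_indicator)
  moreover have "integrable lborel (indicator {a<..b} :: real \<Rightarrow> real)"
    by (intro integrable_real_indicator) (simp, cases "a \<le> b", auto)
  ultimately show ?thesis by (simp add: square_integrable_def)
qed

lemma l2_separable: "\<exists>K::l2 set. countable K \<and> closure K = UNIV"
proof -
  let ?C = "l2_indicator ` (\<rat> \<times> \<rat>)"
  have "countable ?C" using countable_rat by auto
  then obtain K where K: "countable K" "span ?C \<subseteq> closure K"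
    using span_countable_separable by blast
  let ?V = "closure (span ?C)"
  have V: "subspace ?V"
    unfolding subspace_def
  proof (intro conjI ballI allI)
    show "0 \<in> ?V" by (intro subsetD[OF closure_subset] span_zero)
  next
    fix x y assume "x \<in> ?V" "y \<in> ?V"
    then obtain a b where "\<And>n. a n \<in> span ?C" "a \<longlonglongrightarrow> x" "\<And>n. b n \<in> span ?C" "b \<longlonglongrightarrow> y"
      unfolding closure_sequential by blast
    then show "x + y \<in> ?V"
      unfolding closure_sequential
      by (intro exI[of _ "\<lambda>n. a n + b n"] conjI allI span_add tendsto_add)
  next
    fix c :: real and x assume "x \<in> ?V"
    then obtain a where "\<And>n. a n \<in> span ?C" "a \<longlonglongrightarrow> x"
      unfolding closure_sequential by blast
    then show "c *\<^sub>R x \<in> ?V"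
      unfolding closure_sequential
      by (intro exI[of _ "\<lambda>n. c *\<^sub>R a n"] conjI allI span_scale tendsto_scaleR tendsto_const)
  qed
  have "f \<in> ?V" for f
  proof -
    obtain p where p: "p \<in> ?V" "\<forall>v\<in>?V. inner (f - p) v = 0"
      using closed_subspace_projection_exists[OF V closed_closure] by blast
    obtain g where g: "square_integrable g" "f - p = abs_l2 g" by (metis abs_l2_surj)
    have "AE t in lborel. g t = 0"
    proof (rule AE_zero_if_Ioc_integrals_zero)
      show "g \<in> borel_measurable borel" using g(1) by (rule square_integrable_measurable)
      fix a b :: real assume ab: "a \<in> \<rat>" "b \<in> \<rat>"
      show "integrable lborel (\<lambda>t. indicator {a<..b} t * g t)"
        by (intro square_integrable_mult square_integrable_indicator g)
      have "l2_indicator (a, b) \<in> ?V"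
        using ab by (intro subsetD[OF closure_subset] span_base imageI SigmaI)
      then have "inner (l2_indicator (a, b)) (f - p) = 0" using p(2) by (subst inner_commute) (rule bspec)
      then show "(LINT t|lborel. indicator {a<..b} t * g t) = 0"
        unfolding g(2) l2_indicator_def prod.case
          inner_abs_l2[OF square_integrable_indicator g(1)] .
    qed
    then have "l2_rel g (\<lambda>t. 0)" using g(1) by (simp add: l2_rel_def square_integrable_zero)
    then have "abs_l2 g = 0" unfolding zero_l2_def by (rule Quotient_rel_abs[OF Quotient_l2])
    with g(2) p(1) show ?thesis by simp
  qed
  then have "UNIV \<subseteq> ?V" by auto
  also have "?V \<subseteq> closure K" using K(2) closed_closure by (rule closure_minimal)
  finally have "closure K = UNIV" by (rule top.extremum_uniqueI)
  with K(1) show ?thesis by (intro exI conjI)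
qed

instance l2 :: second_countable_topology
proof
  from l2_separable obtain K :: "l2 set" where "countable K" "closure K = UNIV" by (elim exE conjE)
  then show "\<exists>B::l2 set set. countable B \<and> open = generate_topology B"
    by (rule separable_imp_countable_subbasis)
qed

definition L2_on :: "real set \<Rightarrow> l2 set" where
  "L2_on T = {abs_l2 f | f. square_integrable f \<and> (\<forall>t. t \<notin> T \<longrightarrow> f t = 0)}"

lemma inner_L2_on:
  assumes "square_integrable f" "square_integrable g" "\<And>t. t \<notin> T \<Longrightarrow> f t = 0"
  shows "inner (abs_l2 f) (abs_l2 g) = (LINT t:T|lborel. f t * g t)"
  unfolding inner_abs_l2[OF assms(1,2)] set_lebesgue_integral_def
  by (rule Bochner_Integration.integral_cong) (use assms(3) in \<open>auto simp: indicator_def\<close>)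

definition law_support :: "'a::topological_space measure \<Rightarrow> 'a set" where
  "law_support \<mu> = {f. \<forall>U. open U \<and> f \<in> U \<longrightarrow> 0 < emeasure \<mu> U}"

definition closed_support_space :: "'w measure \<Rightarrow> ('w \<Rightarrow> l2) \<Rightarrow> l2 set" where
  "closed_support_space M X = (\<lambda>V. subspace V \<and> closed V) hull law_support (distr M borel X)"

definition identifiable :: "real set \<Rightarrow> l2 set \<Rightarrow> l2 set \<Rightarrow> bool" where
  "identifiable T S D \<longleftrightarrow> D \<inter> (L2_on T \<inter> orthogonal_comp S) = {0}"

definition orth_proj :: "'a::real_inner set \<Rightarrow> 'a \<Rightarrow> 'a" where
  "orth_proj S f = (THE p. p \<in> S \<and> (\<forall>s\<in>S. orthogonal (f - p) s))"

definition orthonormal_basis :: "('d::finite \<Rightarrow> 'a::real_inner) \<Rightarrow> 'a set \<Rightarrow> bool" where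
  "orthonormal_basis \<phi> V \<longleftrightarrow>
    (\<forall>j k. inner (\<phi> j) (\<phi> k) = (if j = k then 1 else 0)) \<and> span (range \<phi>) = V"

definition is_lse :: "nat \<Rightarrow> (nat \<Rightarrow> l2) \<Rightarrow> (nat \<Rightarrow> real) \<Rightarrow> l2 set \<Rightarrow> l2 \<Rightarrow> bool" where
  "is_lse n \<xi> \<eta> D = is_arg_min (\<lambda>b. \<Sum>i=1..n. (\<eta> i - inner (\<xi> i) b)\<^sup>2) (\<lambda>b. b \<in> D)"

text \<open>
  Whether the minimiser is unique depends only on the design \<open>\<xi>\<close>, not on the responses.
  On the remaining designs the estimator is given the dummy value 0, so that it is a random
  variable defined everywhere.
\<close>

definition lse_uniquely_defined :: "nat \<Rightarrow> (nat \<Rightarrow> l2) \<Rightarrow> l2 set \<Rightarrow> bool" where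
  "lse_uniquely_defined n \<xi> D \<longleftrightarrow> (\<forall>\<eta>. \<exists>!b. is_lse n \<xi> \<eta> D b)"

definition lse :: "nat \<Rightarrow> (nat \<Rightarrow> l2) \<Rightarrow> (nat \<Rightarrow> real) \<Rightarrow> l2 set \<Rightarrow> l2" where
  "lse n \<xi> \<eta> D = (if lse_uniquely_defined n \<xi> D then THE b. is_lse n \<xi> \<eta> D b else 0)"

definition lse_coords ::
  "nat \<Rightarrow> (nat \<Rightarrow> l2) \<Rightarrow> (nat \<Rightarrow> real) \<Rightarrow> l2 set \<Rightarrow> ('d::finite \<Rightarrow> l2) \<Rightarrow> real ^ 'd" where
  "lse_coords n \<xi> \<eta> D \<phi> = (\<chi> k. inner (\<phi> k) (lse n \<xi> \<eta> D))"

definition projection_matrix :: "('d::finite \<Rightarrow> l2) \<Rightarrow> ('d \<Rightarrow> l2) \<Rightarrow> real ^ 'd ^ 'd" where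
  "projection_matrix \<phi>E \<phi>D = (\<chi> j k. inner (\<phi>E j) (\<phi>D k))"

definition sigma_generated ::
  "'w measure \<Rightarrow> nat \<Rightarrow> (nat \<Rightarrow> 'w \<Rightarrow> 'a::topological_space) \<Rightarrow> 'w measure" where
  "sigma_generated M n Z =
    vimage_algebra (space M) (\<lambda>\<omega>. \<lambda>i\<in>{1..n}. Z i \<omega>) (PiM {1..n} (\<lambda>_. borel))"

text \<open>
  \<open>real_cond_exp\<close> is the difference of the conditional expectations of the positive and negative
  parts, which are defined for every measurable function. Hence no unconditional moments of the
  estimator are required, only that its conditional moments are finite.
\<close>

definition cond_cov :: "'w measure \<Rightarrow> 'w measure \<Rightarrow> ('w \<Rightarrow> real ^ 'd) \<Rightarrow> 'w \<Rightarrow> real ^ 'd ^ 'd" where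
  "cond_cov M F Z \<omega> = (\<chi> j k. real_cond_exp M F
    (\<lambda>\<omega>'. (Z \<omega>' $ j - real_cond_exp M F (\<lambda>\<omega>. Z \<omega> $ j) \<omega>') *
          (Z \<omega>' $ k - real_cond_exp M F (\<lambda>\<omega>. Z \<omega> $ k) \<omega>')) \<omega>)"

definition eigenvalue :: "real ^ 'd ^ 'd \<Rightarrow> real \<Rightarrow> bool" where
  "eigenvalue A \<mu> \<longleftrightarrow> (\<exists>v. v \<noteq> 0 \<and> A *v v = \<mu> *\<^sub>R v)"

text \<open>
  \<open>\<nu> 1 \<ge> \<dots> \<ge> \<nu> d\<close> lists the eigenvalues with multiplicity, i.e. the roots of the characteristic
  polynomial.
\<close>

definition ordered_eigenvalues :: "real ^ 'd ^ 'd \<Rightarrow> (nat \<Rightarrow> real) \<Rightarrow> bool" where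
  "ordered_eigenvalues A \<nu> \<longleftrightarrow>
    (\<forall>z. det (mat z - A) = (\<Prod>k=1..CARD('d). z - \<nu> k)) \<and>
    (\<forall>j k. 1 \<le> j \<and> j \<le> k \<and> k \<le> CARD('d) \<longrightarrow> \<nu> k \<le> \<nu> j)"

end

theory Submission
  imports Defs
begin

text \<open>
  Almost surely every design point lies in \<open>S\<close>, so regressing on \<open>b\<close> and on its projection onto
  \<open>S\<close> gives the same residuals. Hence the normal equations on \<open>D\<close> are those on \<open>E\<close> after the
  change of variables \<open>P\<close>, and the estimators satisfy $\hat\beta^E = P \hat\beta^D$ almost surely,
  which gives the covariance identity by bilinearity. Since the conditional moments need not come
  from unconditional ones, bilinearity is applied on \<open>F\<close>-measurable events where the weights of
  the responses are bounded; these exhaust the sample space.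

  All eigenvalue bounds are one Courant--Fischer comparison: if $\|Q^T v\|^2 \le c \|v\|^2$ for
  all $v$, the ordered eigenvalues of $Q A Q^T$ are at most $c$ times those of the positive
  semidefinite matrix $A$. It is applied to $Q = P$, which is a contraction, and to $Q = P^{-1}$,
  which is an isometry if \<open>D \<subseteq> S\<close> and has squared norm at most $1 / \epsilon_D$ in (iii).
\<close>

section \<open>Eigenvalues of symmetric matrices\<close>

text \<open>Probability enters through two almost sure facts only: the conditional covariance for
  \<open>D\<close> is the congruence by \<open>matrix_inv P\<close> of the one for \<open>E\<close>,
  and the latter is positive semidefinite. Outside one null set, chosen before the eigenvalue lists
  and \<open>\<epsilon>D\<close>, everything is matrix algebra at a fixed sample point. What helps
  is locality: on an event of \<open>F\<close>, the conditional expectation of \<open>g\<close> is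
  determined by \<open>g\<close> on that event. Semidefiniteness matters because the comparison
  multiplies a bound on squared norms by an eigenvalue. Identifiability makes \<open>P\<close>
  invertible: a kernel vector of \<open>P\<close> is the coordinate vector of an element of
  \<open>D\<close> orthogonal to \<open>S\<close>.\<close>

lemma linear_coeff_zero_if_quadratic_nonneg:
  fixes b c :: real
  assumes "\<And>t. 0 \<le> 2 * t * b + t\<^sup>2 * c"
  shows "b = 0"
proof (rule ccontr)
  assume b: "b \<noteq> 0"
  \<comment> \<open>This minimises the quadratic with \<open>c\<close> replaced by the larger,
    positive number \<open>\<bar>c\<bar> + 1\<close>, which avoids a case split on the sign of
    \<open>c\<close>.\<close>
  define t where "t = - b / (\<bar>c\<bar> + 1)"
  have p: "\<bar>c\<bar> + 1 > 0" by simp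
  have "2 * t * b + t\<^sup>2 * c \<le> 2 * t * b + t\<^sup>2 * (\<bar>c\<bar> + 1)"
    by (intro add_left_mono mult_left_mono) auto
  also have "\<dots> = - b\<^sup>2 / (\<bar>c\<bar> + 1)"
  proof -
    have "t * (\<bar>c\<bar> + 1) = - b" using p by (simp add: t_def)
    then have "2 * t * b + t\<^sup>2 * (\<bar>c\<bar> + 1) = t * b"
      by (simp add: power2_eq_square mult.assoc)
    then show ?thesis by (simp add: t_def power2_eq_square)
  qed
  also have "\<dots> < 0" using p b by (simp add: divide_neg_pos)
  finally show False using assms[of t] by simp
qed

lemma orthonormal_span_expansion:
  fixes u :: "'i \<Rightarrow> 'a::real_inner"
  assumes on: "\<And>i j. inner (u i) (u j) = (if i = j then 1 else 0)"
    and J: "finite J" and v: "v \<in> span (u ` J)"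
  shows "v = (\<Sum>i\<in>J. inner (u i) v *\<^sub>R u i)"
  using v
proof (induction rule: span_induct_alt)
  case base
  then show ?case by simp
next
  case (step c x y)
  then obtain j where j: "j \<in> J" "x = u j" by auto
  have "(\<Sum>i\<in>J. inner (u i) (c *\<^sub>R x + y) *\<^sub>R u i)
      = (\<Sum>i\<in>J. (if i = j then c else 0) *\<^sub>R u i) + (\<Sum>i\<in>J. inner (u i) y *\<^sub>R u i)"
    unfolding sum.distrib[symmetric] j(2)
    by (intro sum.cong) (auto simp: inner_add_right on scaleR_add_left)
  also have "(\<Sum>i\<in>J. (if i = j then c else 0) *\<^sub>R u i) = c *\<^sub>R x"
    using J j by (simp add: if_distrib[of "\<lambda>a. a *\<^sub>R _"] cong: if_cong)
  finally show ?case using step by simp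
qed

text \<open>A maximiser \<open>u\<close> of the Rayleigh quotient on the compact unit sphere of
  \<open>V\<close> is a critical point: \<open>\<mu> u - f u\<close> is orthogonal to all of
  \<open>V\<close>. By invariance it also lies in \<open>V\<close>, so it vanishes.\<close>

lemma selfadjoint_eigenvector_exists:
  fixes f :: "'a::euclidean_space \<Rightarrow> 'a"
  assumes f: "linear f" and sa: "\<And>x y. inner (f x) y = inner x (f y)"
    and V: "subspace V" "\<And>x. x \<in> V \<Longrightarrow> f x \<in> V" "V \<noteq> {0}"
  obtains u \<mu> where "u \<in> V" "norm u = 1" "f u = \<mu> *\<^sub>R u"
proof -
  interpret f: linear f by fact
  let ?S = "V \<inter> sphere 0 1"
  have "compact ?S"
    using closed_subspace[OF V(1)] by (intro closed_Int_compact) auto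
  moreover obtain w where w: "w \<in> V" "w \<noteq> 0" using V(1,3) subspace_0 by blast
  have "w /\<^sub>R norm w \<in> ?S" using w V(1) by (auto simp: subspace_scale)
  then have "?S \<noteq> {}" by blast
  moreover have "continuous_on ?S (\<lambda>x. inner x (f x))"
    by (intro continuous_intros linear_continuous_on linear_conv_bounded_linear[THEN iffD1] f)
  ultimately obtain u where u: "u \<in> ?S" and max: "\<And>x. x \<in> ?S \<Longrightarrow> inner x (f x) \<le> inner u (f u)"
    using continuous_attains_sup[of ?S "\<lambda>x. inner x (f x)"] by blast
  define \<mu> where "\<mu> = inner u (f u)"
  have uu: "inner u u = 1" using u by (simp add: norm_eq_1)
  have le: "inner x (f x) \<le> \<mu> * inner x x" if "x \<in> V" for x
  proof (cases "x = 0")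
    case True
    then show ?thesis by simp
  next
    case False
    have "inner (x /\<^sub>R norm x) (f (x /\<^sub>R norm x)) \<le> \<mu>"
      unfolding \<mu>_def using that False V(1) by (intro max) (auto simp: subspace_scale)
    then have "inner x (f x) / (norm x)\<^sup>2 \<le> \<mu>"
      by (simp add: f.scaleR power2_eq_square divide_inverse mult.commute mult.left_commute)
    then show ?thesis
      using False by (simp add: divide_le_eq power2_norm_eq_inner)
  qed
  \<comment> \<open>The form \<open>\<mu> * inner x x - inner x (f x)\<close> is nonnegative on
    \<open>V\<close> and zero at \<open>u\<close>, so along \<open>u + t w\<close> it has no
    constant term.\<close>
  have orth: "inner w (\<mu> *\<^sub>R u - f u) = 0" if w: "w \<in> V" for w
  proof (rule linear_coeff_zero_if_quadratic_nonneg)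
    fix t :: real
    have "u + t *\<^sub>R w \<in> V" using u w V(1) by (simp add: subspace_add subspace_scale)
    from le[OF this]
    have "0 \<le> \<mu> * inner (u + t *\<^sub>R w) (u + t *\<^sub>R w) - inner (u + t *\<^sub>R w) (f (u + t *\<^sub>R w))"
      by simp
    also have "\<dots> = 2 * t * inner w (\<mu> *\<^sub>R u - f u) + t\<^sup>2 * (\<mu> * inner w w - inner w (f w))"
      using sa[of u w]
      by (simp add: f.add f.scaleR inner_add_left inner_add_right inner_diff_right uu
          inner_commute[of u w] inner_commute[of w "f u"] \<mu>_def[symmetric] power2_eq_square algebra_simps)
    finally show "0 \<le> 2 * t * inner w (\<mu> *\<^sub>R u - f u) + t\<^sup>2 * (\<mu> * inner w w - inner w (f w))" .
  qed
  have "\<mu> *\<^sub>R u - f u \<in> V" using u V(1,2) by (simp add: subspace_diff subspace_scale)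
  from orth[OF this] have "f u = \<mu> *\<^sub>R u" by simp
  with u that[of u \<mu>] show thesis by simp
qed

text \<open>Self-adjointness keeps the orthogonal complement of an eigenvector within
  \<open>V\<close> invariant. Stating the result for invariant subspaces lets the induction on the
  dimension reach that complement.\<close>

lemma selfadjoint_eigenbasis_subspace:
  fixes f :: "'a::euclidean_space \<Rightarrow> 'a"
  assumes f: "linear f" and sa: "\<And>x y. inner (f x) y = inner x (f y)"
    and V: "subspace V" "\<And>x. x \<in> V \<Longrightarrow> f x \<in> V"
  shows "\<exists>B. finite B \<and> span B = V \<and> pairwise orthogonal B \<and> (\<forall>b\<in>B. norm b = 1 \<and> (\<exists>\<mu>. f b = \<mu> *\<^sub>R b))"
  using V
proof (induction "dim V" arbitrary: V rule: less_induct)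
  case less
  show ?case
  proof (cases "V = {0}")
    case True
    then show ?thesis by (intro exI[of _ "{}"]) auto
  next
    case False
    then obtain u \<mu> where u: "u \<in> V" "norm u = 1" "f u = \<mu> *\<^sub>R u"
      using selfadjoint_eigenvector_exists[OF f sa less.prems] by metis
    define W where "W = {x \<in> V. inner u x = 0}"
    have W: "subspace W"
      using less.prems(1) unfolding W_def subspace_def by (auto simp: inner_add_right)
    have Wf: "f x \<in> W" if "x \<in> W" for x
      using that less.prems(2) sa[of u x] u(3) by (auto simp: W_def)
    have uu: "inner u u = 1" using u(2) by (simp add: norm_eq_1)
    have "u \<notin> W" using uu by (simp add: W_def)
    moreover have "W \<subseteq> V" by (auto simp: W_def)
    ultimately have "W \<subset> V" using u(1) by blast
    then have "dim W < dim V"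
      using W less.prems(1) by (intro dim_psubset) (simp add: span_eq_iff[THEN iffD2])
    from less.hyps[OF this W Wf] obtain B where B: "finite B" "span B = W" "pairwise orthogonal B"
      "\<forall>b\<in>B. norm b = 1 \<and> (\<exists>\<mu>. f b = \<mu> *\<^sub>R b)" by blast
    have "B \<subseteq> W" using B(2) span_superset by blast
    then have "pairwise orthogonal (insert u B)"
      using B(3) by (auto simp: pairwise_insert W_def orthogonal_def inner_commute)
    moreover have "span (insert u B) = V"
    proof (rule antisym)
      show "span (insert u B) \<subseteq> V"
        using \<open>B \<subseteq> W\<close> u(1) less.prems(1) by (intro span_minimal) (auto simp: W_def)
      show "V \<subseteq> span (insert u B)"
      proof
        fix v assume v: "v \<in> V"
        have "v - inner u v *\<^sub>R u \<in> W"
          using v u(1) less.prems(1) uu by (auto simp: W_def subspace_diff subspace_scale inner_diff_right)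
        then show "v \<in> span (insert u B)"
          unfolding span_insert using B(2) by blast
      qed
    qed
    ultimately show ?thesis
      using B(1,4) u by (intro exI[of _ "insert u B"]) auto
  qed
qed

section \<open>Orthonormal eigenbases and characteristic polynomials of symmetric matrices\<close>

lemma inner_matrix_vector_symmetric:
  fixes A :: "real ^ 'd ^ 'd"
  assumes "transpose A = A"
  shows "inner (A *v x) y = inner x (A *v y)"
  using dot_lmul_matrix[of x A y] transpose_matrix_vector[of A x] assms by simp

text \<open>Indexing by \<open>'d\<close> itself keeps multiplicities and lets the eigenvectors
  serve as the columns of a square matrix.\<close>

lemma symmetric_matrix_eigenbasis:
  fixes A :: "real ^ 'd ^ 'd"
  assumes A: "transpose A = A"
  obtains u :: "'d \<Rightarrow> real ^ 'd" and \<mu> where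
    "\<And>i j. inner (u i) (u j) = (if i = j then 1 else 0)" "\<And>i. A *v u i = \<mu> i *\<^sub>R u i"
proof -
  obtain B :: "(real ^ 'd) set" where B: "finite B" "span B = UNIV" "pairwise orthogonal B"
      "\<forall>b\<in>B. norm b = 1 \<and> (\<exists>\<mu>. A *v b = \<mu> *\<^sub>R b)"
    using selfadjoint_eigenbasis_subspace[of "(*v) A" UNIV]
      inner_matrix_vector_symmetric[OF A] matrix_vector_mul_linear by auto
  have "0 \<notin> B" using B(4) by force
  then have "independent B" using B(3) by (intro pairwise_orthogonal_independent)
  then have "card B = CARD('d)" using B(2) dim_eq_card_independent[of B] dim_span[of B] by simp
  then obtain u where u: "bij_betw u (UNIV :: 'd set) B"
    using B(1) finite_same_card_bij[of "UNIV :: 'd set" B] by auto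
  have uB: "u i \<in> B" for i using u by (auto simp: bij_betw_def)
  then have "\<forall>i. \<exists>\<mu>. A *v u i = \<mu> *\<^sub>R u i" using B(4) by blast
  then obtain \<mu> where "\<And>i. A *v u i = \<mu> i *\<^sub>R u i" by metis
  moreover have "inner (u i) (u j) = (if i = j then 1 else 0)" for i j
  proof (cases "i = j")
    case True
    then show ?thesis using B(4) uB[of i] by (simp add: norm_eq_1)
  next
    case False
    then have "u i \<noteq> u j" using u by (auto simp: bij_betw_def inj_on_def)
    then show ?thesis using B(3) uB False by (auto simp: pairwise_def orthogonal_def)
  qed
  ultimately show thesis using that by blast
qed

text \<open>With the eigenvectors as columns of \<open>U\<close> and the diagonal matrix
  \<open>L\<close>, one has \<open>(mat z - A) ** U = U ** L\<close>; taking determinants, the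
  nonzero factor \<open>det U\<close> cancels.\<close>

lemma det_char_poly_eigenbasis:
  fixes A :: "real ^ 'd ^ 'd" and u :: "'d \<Rightarrow> real ^ 'd"
  assumes u: "\<And>i j. inner (u i) (u j) = (if i = j then 1 else (0::real))"
    and eig: "\<And>i. A *v u i = \<mu> i *\<^sub>R u i"
  shows "det (mat z - A) = (\<Prod>i\<in>UNIV. z - \<mu> i)"
proof -
  define U where "U = (\<chi> a i. u i $ a)"
  define L where "L = (\<chi> i j. if i = j then z - \<mu> i else 0)"
  have "transpose U ** U = mat 1"
    using u by (simp add: vec_eq_iff U_def matrix_matrix_mult_def transpose_def mat_def inner_vec_def)
  then have "det U \<noteq> 0"
    by (metis det_mul det_I mult_zero_right zero_neq_one)
  have "((mat z - A) ** U) $ a $ i = (U ** L) $ a $ i" for a i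
  proof -
    have "((mat z - A) ** U) $ a $ i = ((mat z - A) *v u i) $ a"
      by (simp add: matrix_matrix_mult_def matrix_vector_mult_def U_def)
    also have "(mat z - A) *v u i = z *\<^sub>R u i - \<mu> i *\<^sub>R u i"
    proof -
      have "mat z *v u i = z *\<^sub>R u i"
        by (simp add: vec_eq_iff matrix_vector_mult_def mat_def if_distrib[of "\<lambda>x. x * _"] cong: if_cong)
      then show ?thesis by (simp add: matrix_vector_mult_diff_rdistrib eig)
    qed
    finally show ?thesis
      by (simp add: matrix_matrix_mult_def U_def L_def if_distrib[of "\<lambda>x. _ * x"] algebra_simps cong: if_cong)
  qed
  then have "(mat z - A) ** U = U ** L" by (simp add: vec_eq_iff)
  then have "det (mat z - A) * det U = det U * det L" by (metis det_mul)
  moreover have "det L = (\<Prod>i\<in>UNIV. z - \<mu> i)"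
    using det_diagonal[of L] by (simp add: L_def)
  ultimately show ?thesis using \<open>det U \<noteq> 0\<close> by simp
qed

text \<open>Two real polynomials with the same values are equal, hence have the same roots with
  multiplicity. This links a list of eigenvalues given by the characteristic polynomial to those of
  an eigenbasis.\<close>

lemma mset_roots_unique:
  fixes f :: "'i \<Rightarrow> real" and g :: "'j \<Rightarrow> real"
  assumes fin: "finite I" "finite J"
    and eq: "\<And>z. (\<Prod>i\<in>I. z - f i) = (\<Prod>j\<in>J. z - g j)"
  shows "image_mset f (mset_set I) = image_mset g (mset_set J)"
proof -
  have *: "image_mset h (mset_set K) = proots (\<Prod>i\<in>K. [:- h i, 1:])" for h :: "'k \<Rightarrow> real" and K
  proof -
    have "proots (\<Prod>i\<in>K. [:- h i, 1:]) = (\<Sum>i\<in>K. {#h i#})"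
      by (subst proots_prod) auto
    then show ?thesis by (cases "finite K") (simp_all add: sum_unfold_sum_mset)
  qed
  have "(\<Prod>i\<in>I. [:- f i, 1:]) = (\<Prod>j\<in>J. [:- g j, 1:])"
    by (subst poly_eq_poly_eq_iff[symmetric]) (simp add: fun_eq_iff poly_prod eq)
  then show ?thesis unfolding * by simp
qed

text \<open>The dimension count below needs only how many eigenvalues pass a threshold, so positions
  in \<open>\<nu>\<close> never have to be matched with indices of the eigenbasis.\<close>

lemma ordered_eigenvalues_card:
  fixes A :: "real ^ 'd ^ 'd" and u :: "'d \<Rightarrow> real ^ 'd"
  assumes \<nu>: "ordered_eigenvalues A \<nu>"
    and u: "\<And>i j. inner (u i) (u j) = (if i = j then 1 else (0::real))"
    and eig: "\<And>i. A *v u i = \<mu> i *\<^sub>R u i"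
  shows "card {i. Q (\<mu> i)} = card {k\<in>{1..CARD('d)}. Q (\<nu> k)}"
proof -
  have "image_mset \<mu> (mset_set UNIV) = image_mset \<nu> (mset_set {1..CARD('d)})"
    using \<nu> det_char_poly_eigenbasis[OF u eig] unfolding ordered_eigenvalues_def
    by (intro mset_roots_unique) auto
  from arg_cong[OF this, of "\<lambda>m. size (filter_mset Q m)"] show ?thesis
    by (simp add: filter_mset_image_mset)
qed

section \<open>Quadratic forms on spans of eigenvectors and the eigenvalue comparison\<close>

lemma dim_span_orthonormal:
  fixes u :: "'d::finite \<Rightarrow> 'a::euclidean_space"
  assumes u: "\<And>i j. inner (u i) (u j) = (if i = j then 1 else (0::real))"
  shows "dim (span (u ` J)) = card J"
proof -
  have inj: "inj u"
    using u by (intro injI) (metis zero_neq_one)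
  have "0 \<notin> u ` J" using u by (metis imageE inner_zero_left zero_neq_one)
  moreover have "pairwise orthogonal (u ` J)"
    by (auto simp: pairwise_def orthogonal_def u)
  ultimately have "independent (u ` J)" by (intro pairwise_orthogonal_independent)
  then show ?thesis
    using dim_eq_card_independent[of "u ` J"] card_image[OF inj_on_subset[OF inj subset_UNIV], of J]
    by simp
qed

lemma eigenbasis_quadratic_form:
  fixes A :: "real ^ 'd ^ 'd" and u :: "'d \<Rightarrow> real ^ 'd"
  assumes u: "\<And>i j. inner (u i) (u j) = (if i = j then 1 else (0::real))"
    and eig: "\<And>i. A *v u i = \<mu> i *\<^sub>R u i" and v: "v \<in> span (u ` J)"
  shows "inner v (A *v v) = (\<Sum>i\<in>J. \<mu> i * (inner (u i) v)\<^sup>2)" "inner v v = (\<Sum>i\<in>J. (inner (u i) v)\<^sup>2)"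
proof -
  have e: "v = (\<Sum>i\<in>J. inner (u i) v *\<^sub>R u i)"
    using orthonormal_span_expansion[OF u _ v] by simp
  have "A *v v = (\<Sum>i\<in>J. (inner (u i) v * \<mu> i) *\<^sub>R u i)"
    by (subst e) (simp add: linear_sum[OF matrix_vector_mul_linear] matrix_vector_mult_scaleR eig mult.commute)
  then show "inner v (A *v v) = (\<Sum>i\<in>J. \<mu> i * (inner (u i) v)\<^sup>2)"
    by (simp add: inner_sum_right power2_eq_square inner_commute mult_ac)
  show "inner v v = (\<Sum>i\<in>J. (inner (u i) v)\<^sup>2)"
    by (subst (2) e) (simp add: inner_sum_right power2_eq_square inner_commute)
qed

text \<open>
  Courant--Fischer in the form of a dimension count: the span of the top $k$ eigenvectors of
  $Q A Q^T$, transported by $Q^T$, meets the span of the bottom $d - k + 1$ eigenvectors of $A$.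
\<close>

lemma ordered_eigenvalues_congruence_le:
  fixes A Q :: "real ^ 'd ^ 'd"
  assumes A: "transpose A = A" "\<And>v. 0 \<le> inner v (A *v v)"
    and Q: "invertible Q" "\<And>v. (norm (transpose Q *v v))\<^sup>2 \<le> c * (norm v)\<^sup>2"
    and \<nu>A: "ordered_eigenvalues A \<nu>A"
    and \<nu>B: "ordered_eigenvalues (Q ** A ** transpose Q) \<nu>B"
    and k: "k \<in> {1..CARD('d)}"
  shows "\<nu>B k \<le> c * \<nu>A k"
proof -
  let ?B = "Q ** A ** transpose Q" and ?T = "\<lambda>w. transpose Q *v w"
  have B: "transpose ?B = ?B"
    by (simp add: matrix_transpose_mul A(1) matrix_mul_assoc)
  obtain u :: "'d \<Rightarrow> real ^ 'd" and \<alpha> where u: "\<And>i j. inner (u i) (u j) = (if i = j then 1 else 0)" "\<And>i. A *v u i = \<alpha> i *\<^sub>R u i"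
    using symmetric_matrix_eigenbasis[OF A(1)] by metis
  obtain w :: "'d \<Rightarrow> real ^ 'd" and \<gamma> where w: "\<And>i j. inner (w i) (w j) = (if i = j then 1 else 0)" "\<And>i. ?B *v w i = \<gamma> i *\<^sub>R w i"
    using symmetric_matrix_eigenbasis[OF B] by metis
  \<comment> \<open>Eigenvectors are selected by thresholds because \<open>\<gamma>\<close> and
    \<open>\<alpha>\<close> come in no particular order. Repeated eigenvalues can only enlarge these
    sets, and lower bounds on their sizes suffice.\<close>
  define I where "I = {i. \<nu>B k \<le> \<gamma> i}"
  define J where "J = {i. \<alpha> i \<le> \<nu>A k}"
  have "k = card {1..k}" by simp
  also have "\<dots> \<le> card {j\<in>{1..CARD('d)}. \<nu>B k \<le> \<nu>B j}"
    using \<nu>B k by (intro card_mono) (auto simp: ordered_eigenvalues_def)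
  also have "\<dots> = card I"
    unfolding I_def using ordered_eigenvalues_card[OF \<nu>B w, of "\<lambda>x. \<nu>B k \<le> x"] by simp
  finally have cI: "k \<le> card I" .
  have "CARD('d) + 1 - k = card {k..CARD('d)}" by simp
  also have "\<dots> \<le> card {j\<in>{1..CARD('d)}. \<nu>A j \<le> \<nu>A k}"
    using \<nu>A k by (intro card_mono) (auto simp: ordered_eigenvalues_def)
  also have "\<dots> = card J"
    unfolding J_def using ordered_eigenvalues_card[OF \<nu>A u, of "\<lambda>x. x \<le> \<nu>A k"] by simp
  finally have cJ: "CARD('d) + 1 - k \<le> card J" .
  let ?U = "?T ` span (w ` I)" and ?W = "span (u ` J)"
  have "invertible (transpose Q)" using Q(1) by (rule transpose_invertible)
  then have inj: "inj ?T" by (rule inj_matrix_vector_mult)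
  have sU: "subspace ?U" by (intro linear_subspace_image subspace_span matrix_vector_mul_linear)
  have dU: "dim ?U = card I"
    using dim_image_eq[OF matrix_vector_mul_linear, of "transpose Q" "span (w ` I)"]
      dim_span_orthonormal[of w, OF w(1)] inj by (metis inj_on_subset subset_UNIV)
  have dW: "dim ?W = card J" by (rule dim_span_orthonormal[of u, OF u(1)])
  have "dim {x + y |x y. x \<in> ?U \<and> y \<in> ?W} \<le> CARD('d)"
    using dim_subset_UNIV[of "{x + y |x y. x \<in> ?U \<and> y \<in> ?W}"] by simp
  \<comment> \<open>The two dimensions add up to at least \<open>k + (CARD('d) + 1 - k)\<close>, one
    more than that of the whole space.\<close>
  then have "dim (?U \<inter> ?W) \<noteq> 0"
    using dim_sums_Int[OF sU subspace_span[of "u ` J"]] cI cJ k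
    unfolding atLeastAtMost_iff dU dW by linarith
  then obtain v where v: "v \<in> ?U" "v \<in> ?W" "v \<noteq> 0"
    using dim_eq_0[of "?U \<inter> ?W"] by auto
  then obtain q where q: "q \<in> span (w ` I)" "v = ?T q" by blast
  have q0: "(norm q)\<^sup>2 > 0" using v(3) q(2) by auto
  have v0: "(norm v)\<^sup>2 > 0" using v(3) by simp
  have "\<nu>B k * (norm q)\<^sup>2 = (\<Sum>i\<in>I. \<nu>B k * (inner (w i) q)\<^sup>2)"
    unfolding power2_norm_eq_inner eigenbasis_quadratic_form(2)[OF w q(1)] by (rule sum_distrib_left)
  also have "\<dots> \<le> inner q (?B *v q)"
    unfolding eigenbasis_quadratic_form(1)[OF w q(1)]
    by (intro sum_mono mult_right_mono) (auto simp: I_def)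
  also have "inner q (?B *v q) = inner v (A *v v)"
  proof -
    have "?B *v q = Q *v (A *v v)" by (simp add: q(2) flip: matrix_vector_mul_assoc)
    then show ?thesis using dot_lmul_matrix[of q Q "A *v v"] by (simp add: q(2) transpose_matrix_vector)
  qed
  finally have 1: "\<nu>B k * (norm q)\<^sup>2 \<le> inner v (A *v v)" .
  have "inner v (A *v v) \<le> (\<Sum>i\<in>J. \<nu>A k * (inner (u i) v)\<^sup>2)"
    unfolding eigenbasis_quadratic_form(1)[OF u v(2)]
    by (intro sum_mono mult_right_mono) (auto simp: J_def)
  also have "\<dots> = \<nu>A k * (norm v)\<^sup>2"
    unfolding power2_norm_eq_inner eigenbasis_quadratic_form(2)[OF u v(2)] by (rule sum_distrib_left[symmetric])
  finally have 2: "inner v (A *v v) \<le> \<nu>A k * (norm v)\<^sup>2" .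
  \<comment> \<open>Here semidefiniteness of \<open>A\<close> is used: a negative eigenvalue would
    reverse the norm bound when multiplied into it.\<close>
  have "0 \<le> \<nu>A k" using order_trans[OF A(2) 2] v0 by (simp add: zero_le_mult_iff)
  then have "\<nu>A k * (norm v)\<^sup>2 \<le> \<nu>A k * (c * (norm q)\<^sup>2)"
    using Q(2)[of q] by (intro mult_left_mono) (auto simp: q(2))
  with 1 2 have "\<nu>B k * (norm q)\<^sup>2 \<le> (c * \<nu>A k) * (norm q)\<^sup>2" by (simp add: mult_ac)
  then show ?thesis using q0 by simp
qed

text \<open>A matrix and its transpose have the same operator norm: bound
  \<open>inner w (Q *v (transpose Q *v w))\<close> by Cauchy-Schwarz and cancel a factor. The
  geometric bounds below concern \<open>Q\<close>, whereas the comparison of eigenvalues asks for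
  its transpose.\<close>

lemma norm_transpose_le:
  fixes Q :: "real ^ 'd ^ 'd"
  assumes "\<And>v. (norm (Q *v v))\<^sup>2 \<le> c * (norm v)\<^sup>2"
  shows "(norm (transpose Q *v w))\<^sup>2 \<le> c * (norm w)\<^sup>2"
proof -
  let ?v = "transpose Q *v w"
  have "(norm ?v)\<^sup>2 = inner w (Q *v ?v)"
    unfolding power2_norm_eq_inner using dot_lmul_matrix[of w Q ?v] by (simp add: transpose_matrix_vector)
  also have "\<dots> \<le> norm w * norm (Q *v ?v)" by (rule norm_cauchy_schwarz)
  finally have "((norm ?v)\<^sup>2)\<^sup>2 \<le> (norm w * norm (Q *v ?v))\<^sup>2" by (intro power_mono) auto
  also have "\<dots> \<le> (norm w)\<^sup>2 * (c * (norm ?v)\<^sup>2)"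
    unfolding power_mult_distrib by (intro mult_left_mono assms) auto
  finally have "(norm ?v)\<^sup>2 * (norm ?v)\<^sup>2 \<le> (c * (norm w)\<^sup>2) * (norm ?v)\<^sup>2"
    by (simp add: power2_eq_square mult_ac)
  then have "(norm ?v)\<^sup>2 \<le> c * (norm w)\<^sup>2" if "norm ?v \<noteq> 0"
    by (rule mult_right_le_imp_le) (use that in simp)
  \<comment> \<open>Covers the case where nothing can be cancelled; the sign of \<open>c\<close> is
    read off from the hypothesis at a unit vector.\<close>
  moreover have "c \<ge> 0" using order_trans[OF zero_le_power2 assms[of "axis undefined 1"]] by simp
  ultimately show ?thesis by (cases "norm ?v = 0") auto
qed

text \<open>The squared norm of \<open>P *v v\<close> is the quadratic form of
  \<open>transpose P ** P\<close>, whose coefficients in an eigenbasis all exceed \<open>e\<close>.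
  Evaluated at \<open>matrix_inv P *v w\<close>, this bounds the inverse, as (iii) requires.\<close>

lemma eigenvalue_gt_imp_norm_ge:
  fixes P :: "real ^ 'd ^ 'd"
  assumes "\<And>\<mu>. eigenvalue (transpose P ** P) \<mu> \<Longrightarrow> \<mu> > e"
  shows "e * (norm v)\<^sup>2 \<le> (norm (P *v v))\<^sup>2"
proof -
  have sym: "transpose (transpose P ** P) = transpose P ** P" by (simp add: matrix_transpose_mul)
  obtain u :: "'d \<Rightarrow> real ^ 'd" and \<mu> where u: "\<And>i j. inner (u i) (u j) = (if i = j then 1 else 0)" "\<And>i. (transpose P ** P) *v u i = \<mu> i *\<^sub>R u i"
    using symmetric_matrix_eigenbasis[OF sym] by metis
  have \<mu>: "\<mu> i > e" for i
  proof (rule assms)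
    have "u i \<noteq> 0" using u(1)[of i i] by force
    then show "eigenvalue (transpose P ** P) (\<mu> i)" using u(2) by (auto simp: eigenvalue_def)
  qed
  have "v \<in> span (range u)"
  proof -
    have "dim (span (range u)) = DIM(real ^ 'd)"
      using dim_span_orthonormal[of u UNIV, OF u(1)] by simp
    then have "span (range u) = UNIV" using dim_eq_full[of "range u"] by (simp add: dim_span)
    then show ?thesis by simp
  qed
  note q = eigenbasis_quadratic_form[OF u this]
  have "e * (norm v)\<^sup>2 \<le> inner v ((transpose P ** P) *v v)"
    unfolding power2_norm_eq_inner q sum_distrib_left
    using less_imp_le[OF \<mu>] by (intro sum_mono mult_right_mono) auto
  also have "\<dots> = inner (P *v v) (P *v v)"
    using dot_lmul_matrix[of "P *v v" P v]
    by (simp add: matrix_vector_mul_assoc[symmetric] transpose_matrix_vector inner_commute)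
  finally show ?thesis by (simp add: power2_norm_eq_inner)
qed

section \<open>Least squares\<close>

text \<open>
  For singular \<open>G\<close> division by zero makes this 0, which is also the dummy value of \<open>lse\<close>, so the
  formula for the coordinates of the estimator below needs no case distinction.
\<close>

definition cramer_solve :: "real ^ 'd ^ 'd \<Rightarrow> real ^ 'd \<Rightarrow> real ^ 'd" where
  "cramer_solve G r = (\<chi> k. det (\<chi> i j. if j = k then r $ i else G $ i $ j) / det G)"

lemma cramer_solve_unique: "det G \<noteq> 0 \<Longrightarrow> G *v c = r \<longleftrightarrow> c = cramer_solve G r"
  unfolding cramer_solve_def by (rule cramer)

lemma cramer_solve_singular: "det G = 0 \<Longrightarrow> cramer_solve G r = 0"
  by (simp add: cramer_solve_def vec_eq_iff)

text \<open>Linearity in the right-hand side, singular case included; it exhibits the estimator as a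
  combination of the responses with coefficients depending on the design.\<close>

lemma cramer_solve_expansion:
  "cramer_solve G r = (\<Sum>k\<in>UNIV. r $ k *\<^sub>R cramer_solve G (axis k 1))"
proof (cases "det G = 0")
  case True
  then show ?thesis by (simp add: cramer_solve_singular)
next
  case False
  have "G *v cramer_solve G (axis k 1) = axis k 1" for k
    using cramer_solve_unique[OF False] by blast
  then have "G *v (\<Sum>k\<in>UNIV. r $ k *\<^sub>R cramer_solve G (axis k 1)) = (\<Sum>k\<in>UNIV. r $ k *\<^sub>R axis k 1)"
    by (simp add: linear_sum[OF matrix_vector_mul_linear] matrix_vector_mult_scaleR)
  also have "\<dots> = r"
    by (simp add: vec_eq_iff axis_def if_distrib[of "\<lambda>a. _ * a"] cong: if_cong)
  finally show ?thesis using cramer_solve_unique[OF False] by metis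
qed

lemma borel_measurable_det:
  fixes A :: "'a \<Rightarrow> real ^ 'd ^ 'd"
  assumes "\<And>i j. (\<lambda>x. A x $ i $ j) \<in> borel_measurable N"
  shows "(\<lambda>x. det (A x)) \<in> borel_measurable N"
  unfolding det_def
  by (intro borel_measurable_sum borel_measurable_times borel_measurable_const borel_measurable_prod assms)

text \<open>The reason for solving by determinants: a quotient of polynomials in the entries is
  measurable everywhere, also where the denominator vanishes.\<close>

lemma borel_measurable_cramer_solve:
  fixes A :: "'a \<Rightarrow> real ^ 'd ^ 'd"
  assumes "\<And>i j. (\<lambda>x. A x $ i $ j) \<in> borel_measurable N" "\<And>i. (\<lambda>x. r x $ i) \<in> borel_measurable N"
  shows "(\<lambda>x. cramer_solve (A x) (r x) $ k) \<in> borel_measurable N"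
  unfolding cramer_solve_def vec_lambda_beta
proof (intro borel_measurable_divide borel_measurable_det assms)
  fix i j show "(\<lambda>x. (\<chi> i j. if j = k then r x $ i else A x $ i $ j) $ i $ j) \<in> borel_measurable N"
    using assms by (cases "j = k") auto
qed

section \<open>Gram matrices, normal equations and uniqueness of the minimiser\<close>

definition gram_matrix :: "nat \<Rightarrow> (nat \<Rightarrow> l2) \<Rightarrow> ('d::finite \<Rightarrow> l2) \<Rightarrow> real ^ 'd ^ 'd" where
  "gram_matrix n \<xi> \<phi> = (\<chi> j k. \<Sum>i=1..n. inner (\<xi> i) (\<phi> j) * inner (\<xi> i) (\<phi> k))"

definition moment_vector :: "nat \<Rightarrow> (nat \<Rightarrow> l2) \<Rightarrow> (nat \<Rightarrow> real) \<Rightarrow> ('d::finite \<Rightarrow> l2) \<Rightarrow> real ^ 'd" where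
  "moment_vector n \<xi> \<eta> \<phi> = (\<chi> j. \<Sum>i=1..n. \<eta> i * inner (\<xi> i) (\<phi> j))"

text \<open>Along every line in \<open>V\<close> the residual sum of squares is exactly quadratic
  with nonnegative leading coefficient, so minimality amounts to a vanishing linear
  coefficient.\<close>

lemma is_lse_normal_equations:
  assumes V: "subspace V"
  shows "is_lse n \<xi> \<eta> V b \<longleftrightarrow>
    b \<in> V \<and> (\<forall>v\<in>V. (\<Sum>i=1..n. (\<eta> i - inner (\<xi> i) b) * inner (\<xi> i) v) = 0)"
proof -
  define R where "R b = (\<Sum>i=1..n. (\<eta> i - inner (\<xi> i) b)\<^sup>2)" for b
  define N where "N b v = (\<Sum>i=1..n. (\<eta> i - inner (\<xi> i) b) * inner (\<xi> i) v)" for b v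
  have exp: "R (b + t *\<^sub>R v) = R b + (2 * t * (- N b v) + t\<^sup>2 * (\<Sum>i=1..n. (inner (\<xi> i) v)\<^sup>2))" for b v t
    unfolding R_def N_def sum_distrib_left sum_negf[symmetric] sum.distrib[symmetric]
    by (intro sum.cong) (auto simp: inner_add_right power2_eq_square algebra_simps)
  have "is_lse n \<xi> \<eta> V b \<longleftrightarrow> b \<in> V \<and> (\<forall>c\<in>V. R b \<le> R c)"
    unfolding is_lse_def is_arg_min_def R_def by (auto simp: not_less)
  moreover have "(\<forall>c\<in>V. R b \<le> R c) \<longleftrightarrow> (\<forall>v\<in>V. N b v = 0)" if b: "b \<in> V"
  proof safe
    fix v assume v: "v \<in> V" and min: "\<forall>c\<in>V. R b \<le> R c"
    have "- N b v = 0"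
    proof (rule linear_coeff_zero_if_quadratic_nonneg)
      fix t
      have "b + t *\<^sub>R v \<in> V" using V v b by (simp add: subspace_add subspace_scale)
      then show "0 \<le> 2 * t * (- N b v) + t\<^sup>2 * (\<Sum>i=1..n. (inner (\<xi> i) v)\<^sup>2)"
        using min exp[of b t v] by force
    qed
    then show "N b v = 0" by simp
  next
    fix c assume c: "c \<in> V" and N: "\<forall>v\<in>V. N b v = 0"
    have "c - b \<in> V" using V b c by (simp add: subspace_diff)
    then show "R b \<le> R c" using N exp[of b 1 "c - b"] by (simp add: sum_nonneg)
  qed
  ultimately show ?thesis unfolding N_def by blast
qed

lemma orthonormal_basis_expansion:
  assumes "orthonormal_basis \<phi> V" "b \<in> V"
  shows "b = (\<Sum>k\<in>UNIV. inner (\<phi> k) b *\<^sub>R \<phi> k)"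
  using assms orthonormal_span_expansion[of \<phi> UNIV b] by (simp add: orthonormal_basis_def)

lemma orthonormal_basis_coords:
  assumes "orthonormal_basis \<phi> V"
  shows "inner (\<phi> j) (\<Sum>k\<in>UNIV. c k *\<^sub>R \<phi> k) = c j"
  using assms by (simp add: orthonormal_basis_def inner_sum_right if_distrib[of "\<lambda>a. _ * a"] cong: if_cong)

lemma orthonormal_basis_norm:
  assumes "orthonormal_basis \<phi> V"
  shows "norm (\<Sum>k\<in>UNIV. c $ k *\<^sub>R \<phi> k) = norm c"
proof -
  have "inner (\<Sum>k\<in>UNIV. c $ k *\<^sub>R \<phi> k) (\<Sum>k\<in>UNIV. c $ k *\<^sub>R \<phi> k) = inner c c"
    using orthonormal_basis_coords[OF assms, of _ "($) c"] by (simp add: inner_sum_left inner_vec_def)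
  then show ?thesis by (simp add: norm_eq_sqrt_inner)
qed

text \<open>It suffices to test the normal equations on the basis vectors; expanding
  \<open>b\<close> in the basis then gives a square linear system.\<close>

lemma is_lse_coords_iff:
  assumes \<phi>: "orthonormal_basis \<phi> V"
  shows "is_lse n \<xi> \<eta> V b \<longleftrightarrow>
    b \<in> V \<and> gram_matrix n \<xi> \<phi> *v (\<chi> k. inner (\<phi> k) b) = moment_vector n \<xi> \<eta> \<phi>"
proof -
  have V: "V = span (range \<phi>)" using \<phi> by (simp add: orthonormal_basis_def)
  have "(\<forall>v\<in>V. (\<Sum>i=1..n. (\<eta> i - inner (\<xi> i) b) * inner (\<xi> i) v) = 0) \<longleftrightarrow>
      gram_matrix n \<xi> \<phi> *v (\<chi> k. inner (\<phi> k) b) = moment_vector n \<xi> \<eta> \<phi>" if b: "b \<in> V"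
  proof -
    have "(\<forall>v\<in>V. (\<Sum>i=1..n. (\<eta> i - inner (\<xi> i) b) * inner (\<xi> i) v) = 0) \<longleftrightarrow>
        (\<forall>j. (\<Sum>i=1..n. (\<eta> i - inner (\<xi> i) b) * inner (\<xi> i) (\<phi> j)) = 0)"
    proof safe
      fix v assume v: "v \<in> V" and j: "\<forall>j. (\<Sum>i=1..n. (\<eta> i - inner (\<xi> i) b) * inner (\<xi> i) (\<phi> j)) = 0"
      show "(\<Sum>i=1..n. (\<eta> i - inner (\<xi> i) b) * inner (\<xi> i) v) = 0"
        using v unfolding V
      proof (induction rule: span_induct_alt)
        case (step c x y)
        have "(\<Sum>i=1..n. (\<eta> i - inner (\<xi> i) b) * inner (\<xi> i) (c *\<^sub>R x + y)) =
          c * (\<Sum>i=1..n. (\<eta> i - inner (\<xi> i) b) * inner (\<xi> i) x) + (\<Sum>i=1..n. (\<eta> i - inner (\<xi> i) b) * inner (\<xi> i) y)"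
          unfolding sum_distrib_left sum.distrib[symmetric]
          by (intro sum.cong) (auto simp: inner_add_right algebra_simps)
        then show ?case using step j by auto
      qed simp
    qed (auto simp: V intro: span_base)
    moreover have "(gram_matrix n \<xi> \<phi> *v (\<chi> k. inner (\<phi> k) b)) $ j = (\<Sum>i=1..n. inner (\<xi> i) b * inner (\<xi> i) (\<phi> j))" for j
    proof -
      have "(gram_matrix n \<xi> \<phi> *v (\<chi> k. inner (\<phi> k) b)) $ j =
          (\<Sum>i=1..n. (\<Sum>k\<in>UNIV. inner (\<phi> k) b * inner (\<xi> i) (\<phi> k)) * inner (\<xi> i) (\<phi> j))"
        unfolding matrix_vector_mult_def gram_matrix_def vec_lambda_beta sum_distrib_right
        by (subst sum.swap) (simp add: mult_ac)
      also have "\<dots> = (\<Sum>i=1..n. inner (\<xi> i) b * inner (\<xi> i) (\<phi> j))"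
      proof (intro sum.cong refl)
        fix i
        have "(\<Sum>k\<in>UNIV. inner (\<phi> k) b * inner (\<xi> i) (\<phi> k)) = inner (\<xi> i) b"
          using arg_cong[OF orthonormal_basis_expansion[OF \<phi> b], of "inner (\<xi> i)"]
          by (simp add: inner_sum_right)
        then show "(\<Sum>k\<in>UNIV. inner (\<phi> k) b * inner (\<xi> i) (\<phi> k)) * inner (\<xi> i) (\<phi> j) =
            inner (\<xi> i) b * inner (\<xi> i) (\<phi> j)" by simp
      qed
      finally show ?thesis .
    qed
    ultimately show ?thesis
      by (auto simp: vec_eq_iff moment_vector_def left_diff_distrib sum_subtractf)
  qed
  moreover have "subspace V" unfolding V by (rule subspace_span)
  ultimately show ?thesis by (auto simp: is_lse_normal_equations)
qed

lemma orthonormal_basis_combination_mem: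
  "orthonormal_basis \<phi> V \<Longrightarrow> (\<Sum>k\<in>UNIV. c k *\<^sub>R \<phi> k) \<in> V"
  by (auto simp: orthonormal_basis_def intro!: span_sum span_scale intro: span_base)

text \<open>A kernel vector of the Gram matrix produces a second minimiser already for zero
  responses; a regular Gram matrix solves the system uniquely for all responses.\<close>

lemma lse_uniquely_defined_iff:
  assumes \<phi>: "orthonormal_basis \<phi> V"
  shows "lse_uniquely_defined n \<xi> V \<longleftrightarrow> det (gram_matrix n \<xi> \<phi>) \<noteq> 0"
proof
  assume u: "lse_uniquely_defined n \<xi> V"
  show "det (gram_matrix n \<xi> \<phi>) \<noteq> 0"
  proof
    assume "det (gram_matrix n \<xi> \<phi>) = 0"
    then obtain c where c: "c \<noteq> 0" "gram_matrix n \<xi> \<phi> *v c = 0"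
      by (metis invertible_det_nz invertible_left_inverse matrix_left_invertible_ker)
    let ?b = "\<Sum>k\<in>UNIV. c $ k *\<^sub>R \<phi> k"
    have m0: "moment_vector n \<xi> (\<lambda>_. 0) \<phi> = 0" by (simp add: moment_vector_def vec_eq_iff)
    have cc: "(\<chi> k. inner (\<phi> k) ?b) = c" by (simp add: vec_eq_iff orthonormal_basis_coords[OF \<phi>])
    have "is_lse n \<xi> (\<lambda>_. 0) V ?b"
      using orthonormal_basis_combination_mem[OF \<phi>] by (simp add: is_lse_coords_iff[OF \<phi>] cc c m0)
    moreover have "0 \<in> V" using \<phi> span_zero by (auto simp: orthonormal_basis_def)
    then have "is_lse n \<xi> (\<lambda>_. 0) V 0"
      by (simp add: is_lse_coords_iff[OF \<phi>] m0 zero_vec_def[symmetric])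
    ultimately have "?b = 0" using u unfolding lse_uniquely_defined_def by blast
    then have "c = 0" using cc by (simp add: zero_vec_def[symmetric])
    with c show False by simp
  qed
next
  assume d: "det (gram_matrix n \<xi> \<phi>) \<noteq> 0"
  show "lse_uniquely_defined n \<xi> V"
    unfolding lse_uniquely_defined_def
  proof
    fix \<eta>
    let ?c = "cramer_solve (gram_matrix n \<xi> \<phi>) (moment_vector n \<xi> \<eta> \<phi>)"
    show "\<exists>!b. is_lse n \<xi> \<eta> V b"
    proof
      show "is_lse n \<xi> \<eta> V (\<Sum>k\<in>UNIV. ?c $ k *\<^sub>R \<phi> k)"
        using orthonormal_basis_combination_mem[OF \<phi>] cramer_solve_unique[OF d]
        by (simp add: is_lse_coords_iff[OF \<phi>] orthonormal_basis_coords[OF \<phi>])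
      fix b assume "is_lse n \<xi> \<eta> V b"
      then have "b \<in> V" "(\<chi> k. inner (\<phi> k) b) = ?c"
        using cramer_solve_unique[OF d] by (auto simp: is_lse_coords_iff[OF \<phi>])
      then show "b = (\<Sum>k\<in>UNIV. ?c $ k *\<^sub>R \<phi> k)"
        using orthonormal_basis_expansion[OF \<phi>, of b] by (simp add: vec_eq_iff)
    qed
  qed
qed

lemma lse_coords_eq_cramer_solve:
  assumes \<phi>: "orthonormal_basis \<phi> V"
  shows "lse_coords n \<xi> \<eta> V \<phi> = cramer_solve (gram_matrix n \<xi> \<phi>) (moment_vector n \<xi> \<eta> \<phi>)"
proof (cases "lse_uniquely_defined n \<xi> V")
  case True
  then have d: "det (gram_matrix n \<xi> \<phi>) \<noteq> 0" using lse_uniquely_defined_iff[OF \<phi>] by blast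
  have "is_lse n \<xi> \<eta> V (lse n \<xi> \<eta> V)"
    using True theI'[of "is_lse n \<xi> \<eta> V"] by (simp add: lse_def lse_uniquely_defined_def)
  then show ?thesis
    using cramer_solve_unique[OF d] by (simp add: is_lse_coords_iff[OF \<phi>] lse_coords_def)
next
  case False
  then have "det (gram_matrix n \<xi> \<phi>) = 0" using lse_uniquely_defined_iff[OF \<phi>] by blast
  with False show ?thesis by (simp add: lse_coords_def lse_def cramer_solve_singular vec_eq_iff)
qed

text \<open>For a regular Gram matrix \<open>G\<close> this is the entry \<open>(j, i)\<close> of
  G^{-1} X^T, where X is the design matrix with entries \<open>inner (\<xi> i) (\<phi> k)\<close>.
  It does not involve the responses.\<close>

definition lse_weight :: "nat \<Rightarrow> (nat \<Rightarrow> l2) \<Rightarrow> ('d::finite \<Rightarrow> l2) \<Rightarrow> 'd \<Rightarrow> nat \<Rightarrow> real" where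
  "lse_weight n \<xi> \<phi> j i = (\<Sum>k\<in>UNIV. cramer_solve (gram_matrix n \<xi> \<phi>) (axis k 1) $ j * inner (\<xi> i) (\<phi> k))"

lemma lse_coords_eq_weighted_sum:
  assumes \<phi>: "orthonormal_basis \<phi> V"
  shows "lse_coords n \<xi> \<eta> V \<phi> $ j = (\<Sum>i=1..n. lse_weight n \<xi> \<phi> j i * \<eta> i)"
proof -
  have "lse_coords n \<xi> \<eta> V \<phi> $ j = (\<Sum>k\<in>UNIV. moment_vector n \<xi> \<eta> \<phi> $ k * cramer_solve (gram_matrix n \<xi> \<phi>) (axis k 1) $ j)"
    unfolding lse_coords_eq_cramer_solve[OF \<phi>] by (subst cramer_solve_expansion) simp
  also have "\<dots> = (\<Sum>i=1..n. lse_weight n \<xi> \<phi> j i * \<eta> i)"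
    unfolding moment_vector_def lse_weight_def vec_lambda_beta sum_distrib_right
    by (subst sum.swap) (simp add: mult_ac)
  finally show ?thesis .
qed

lemma borel_measurable_lse_weight:
  assumes x: "\<And>i. i \<in> {1..n} \<Longrightarrow> x i \<in> borel_measurable N" and i: "i \<in> {1..n}"
  shows "(\<lambda>\<omega>. lse_weight n (\<lambda>i. x i \<omega>) \<phi> j i) \<in> borel_measurable N"
proof -
  have x_inner: "(\<lambda>\<omega>. inner (x i \<omega>) f) \<in> borel_measurable N" if "i \<in> {1..n}" for i f
    using x[OF that] by measurable
  show ?thesis
    unfolding lse_weight_def gram_matrix_def
    by (intro borel_measurable_sum borel_measurable_times borel_measurable_cramer_solve x_inner i)
      (auto intro!: borel_measurable_sum borel_measurable_times x_inner)
qed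

text \<open>The hypothesis says that the design matrices satisfy X_D = X_E P. Hence G_D = P^T G_E P
  and r_D = P^T r_E, and cancelling P^T leaves the system for \<open>E\<close>. As \<open>P\<close>
  is invertible, the two Gram matrices are singular together, and then both estimators take the
  value 0.\<close>

lemma lse_coords_change_of_basis:
  fixes P :: "real ^ 'd ^ 'd"
  assumes \<phi>: "orthonormal_basis \<phi>D D" "orthonormal_basis \<phi>E E" and P: "invertible P"
    and \<xi>: "\<And>i k. i \<in> {1..n} \<Longrightarrow> inner (\<xi> i) (\<phi>D k) = (\<Sum>j\<in>UNIV. P $ j $ k * inner (\<xi> i) (\<phi>E j))"
  shows "lse_coords n \<xi> \<eta> E \<phi>E = P *v lse_coords n \<xi> \<eta> D \<phi>D"
proof -
  let ?GD = "gram_matrix n \<xi> \<phi>D" and ?GE = "gram_matrix n \<xi> \<phi>E"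
  let ?rD = "moment_vector n \<xi> \<eta> \<phi>D" and ?rE = "moment_vector n \<xi> \<eta> \<phi>E"
  have G: "?GD = transpose P ** (?GE ** P)"
  proof -
    have "?GD $ j $ k = (transpose P ** (?GE ** P)) $ j $ k" for j k
    proof -
      have "(transpose P ** (?GE ** P)) $ j $ k =
          (\<Sum>a\<in>UNIV. \<Sum>b\<in>UNIV. \<Sum>i=1..n. P $ a $ j * inner (\<xi> i) (\<phi>E a) * (P $ b $ k * inner (\<xi> i) (\<phi>E b)))"
        by (simp add: matrix_matrix_mult_def transpose_def gram_matrix_def sum_distrib_left sum_distrib_right mult_ac)
      also have "\<dots> = (\<Sum>a\<in>UNIV. \<Sum>i=1..n. \<Sum>b\<in>UNIV. P $ a $ j * inner (\<xi> i) (\<phi>E a) * (P $ b $ k * inner (\<xi> i) (\<phi>E b)))"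
        by (intro sum.cong refl sum.swap)
      also have "\<dots> = (\<Sum>i=1..n. \<Sum>a\<in>UNIV. \<Sum>b\<in>UNIV. P $ a $ j * inner (\<xi> i) (\<phi>E a) * (P $ b $ k * inner (\<xi> i) (\<phi>E b)))"
        by (rule sum.swap)
      also have "\<dots> = (\<Sum>i=1..n. inner (\<xi> i) (\<phi>D j) * inner (\<xi> i) (\<phi>D k))"
        by (intro sum.cong refl) (simp only: \<xi> sum_product)
      finally show ?thesis by (simp add: gram_matrix_def)
    qed
    then show ?thesis by (simp add: vec_eq_iff)
  qed
  have r: "?rD = transpose P *v ?rE"
  proof -
    have "?rD $ k = (transpose P *v ?rE) $ k" for k
    proof -
      have "(transpose P *v ?rE) $ k = (\<Sum>j\<in>UNIV. \<Sum>i=1..n. \<eta> i * (P $ j $ k * inner (\<xi> i) (\<phi>E j)))"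
        by (simp add: matrix_vector_mult_def transpose_def moment_vector_def sum_distrib_left mult_ac
            del: transpose_matrix_vector)
      also have "\<dots> = (\<Sum>i=1..n. \<Sum>j\<in>UNIV. \<eta> i * (P $ j $ k * inner (\<xi> i) (\<phi>E j)))"
        by (rule sum.swap)
      also have "\<dots> = (\<Sum>i=1..n. \<eta> i * inner (\<xi> i) (\<phi>D k))"
        by (intro sum.cong refl) (simp only: \<xi> sum_distrib_left)
      finally show ?thesis by (simp add: moment_vector_def)
    qed
    then show ?thesis by (simp add: vec_eq_iff)
  qed
  have dP: "det P \<noteq> 0" using P by (simp add: invertible_det_nz)
  have dG: "det ?GD = det P * (det ?GE * det P)" unfolding G by (simp add: det_mul)
  show ?thesis
  proof (cases "det ?GE = 0")
    case True
    then show ?thesis using dG by (simp add: lse_coords_eq_cramer_solve[OF \<phi>(1)] lse_coords_eq_cramer_solve[OF \<phi>(2)] cramer_solve_singular)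
  next
    case False
    then have d: "det ?GD \<noteq> 0" using dG dP by simp
    have "?GD *v cramer_solve ?GD ?rD = ?rD" using cramer_solve_unique[OF d] by blast
    then have "transpose P *v (?GE *v (P *v cramer_solve ?GD ?rD)) = transpose P *v ?rE"
      unfolding r by (subst (asm) (1) G) (simp only: matrix_vector_mul_assoc matrix_mul_assoc)
    then have "?GE *v (P *v cramer_solve ?GD ?rD) = ?rE"
      using inj_matrix_vector_mult[OF transpose_invertible[OF P]] by (simp only: inj_eq)
    then show ?thesis
      using cramer_solve_unique[OF False] by (simp add: lse_coords_eq_cramer_solve[OF \<phi>(1)] lse_coords_eq_cramer_solve[OF \<phi>(2)])
  qed
qed

section \<open>Conditional covariance\<close>

context finite_measure_subalgebra
begin

text \<open>The indicator of \<open>A\<close> is \<open>F\<close>-measurable, so it can be pulled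
  out of a conditional expectation as soon as the product is integrable; no integrability of
  \<open>g\<close> or \<open>f j\<close> off \<open>A\<close> is asked for.\<close>

lemma real_cond_exp_local_linear:
  fixes f :: "'i \<Rightarrow> 'a \<Rightarrow> real" and c :: "'i \<Rightarrow> real"
  assumes A: "A \<in> sets F" and J: "finite J"
    and fm: "\<And>j. f j \<in> borel_measurable M" and gm: "g \<in> borel_measurable M"
    and int: "\<And>j. integrable M (\<lambda>\<omega>. indicator A \<omega> * f j \<omega>)"
    and g: "AE \<omega> in M. \<omega> \<in> A \<longrightarrow> g \<omega> = (\<Sum>j\<in>J. c j * f j \<omega>)"
  shows "AE \<omega> in M. \<omega> \<in> A \<longrightarrow> real_cond_exp M F g \<omega> = (\<Sum>j\<in>J. c j * real_cond_exp M F (f j) \<omega>)"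
proof -
  let ?I = "\<lambda>\<omega>. indicator A \<omega> :: real"
  let ?s = "\<lambda>\<omega>. \<Sum>j\<in>J. c j * (?I \<omega> * f j \<omega>)"
  have IF: "?I \<in> borel_measurable F" using A by simp
  have IM: "?I \<in> borel_measurable M" by (rule measurable_from_subalg[OF subalg IF])
  have sm: "?s \<in> borel_measurable M"
    by (intro borel_measurable_sum borel_measurable_times IM fm borel_measurable_const)
  have Igm: "(\<lambda>\<omega>. ?I \<omega> * g \<omega>) \<in> borel_measurable M" by (intro borel_measurable_times IM gm)
  have cint: "integrable M (\<lambda>\<omega>. c j * (?I \<omega> * f j \<omega>))" for j by (intro integrable_mult_right int)
  have ae: "AE \<omega> in M. ?I \<omega> * g \<omega> = ?s \<omega>"
    using g by eventually_elim (auto simp: indicator_def)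
  have "integrable M ?s" by (intro Bochner_Integration.integrable_sum cint)
  then have Ig: "integrable M (\<lambda>\<omega>. ?I \<omega> * g \<omega>)"
    using integrable_cong_AE[OF Igm sm ae] by blast
  have 1: "AE \<omega> in M. real_cond_exp M F (\<lambda>\<omega>. ?I \<omega> * g \<omega>) \<omega> = ?I \<omega> * real_cond_exp M F g \<omega>"
    by (rule real_cond_exp_mult[OF IF gm Ig])
  have 2: "AE \<omega> in M. real_cond_exp M F (\<lambda>\<omega>. ?I \<omega> * g \<omega>) \<omega> = real_cond_exp M F ?s \<omega>"
    by (rule real_cond_exp_cong[OF ae Igm sm])
  have 3: "AE \<omega> in M. real_cond_exp M F ?s \<omega> = (\<Sum>j\<in>J. real_cond_exp M F (\<lambda>\<omega>. c j * (?I \<omega> * f j \<omega>)) \<omega>)"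
    by (rule real_cond_exp_sum[OF cint])
  have 4: "AE \<omega> in M. \<forall>j\<in>J. real_cond_exp M F (\<lambda>\<omega>. c j * (?I \<omega> * f j \<omega>)) \<omega> = c j * real_cond_exp M F (\<lambda>\<omega>. ?I \<omega> * f j \<omega>) \<omega>"
    by (intro AE_finite_allI J real_cond_exp_cmult int)
  have 5: "AE \<omega> in M. \<forall>j\<in>J. real_cond_exp M F (\<lambda>\<omega>. ?I \<omega> * f j \<omega>) \<omega> = ?I \<omega> * real_cond_exp M F (f j) \<omega>"
    by (intro AE_finite_allI J real_cond_exp_mult[OF IF fm int])
  from 1 2 3 4 5 show ?thesis
  proof eventually_elim
    case (elim \<omega>)
    show ?case
    proof
      assume "\<omega> \<in> A"
      then have I1: "?I \<omega> = 1" by simp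
      have "real_cond_exp M F g \<omega> = (\<Sum>j\<in>J. real_cond_exp M F (\<lambda>\<omega>. c j * (?I \<omega> * f j \<omega>)) \<omega>)"
        using elim(1,2,3) unfolding I1 by simp
      also have "\<dots> = (\<Sum>j\<in>J. c j * real_cond_exp M F (f j) \<omega>)"
        using elim(4,5) unfolding I1 by simp
      finally show "real_cond_exp M F g \<omega> = (\<Sum>j\<in>J. c j * real_cond_exp M F (f j) \<omega>)" .
    qed
  qed
qed

text \<open>The bound \<open>K\<close> on the conditional means makes the centred products
  integrable on \<open>A\<close>; the identity is then bilinearity.\<close>

lemma cond_cov_linear_transform_on:
  fixes Z W :: "'a \<Rightarrow> real ^ 'd" and B :: "real ^ 'd ^ 'd"
  assumes Z: "\<And>j. (\<lambda>\<omega>. Z \<omega> $ j) \<in> borel_measurable M"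
    and W: "\<And>j. (\<lambda>\<omega>. W \<omega> $ j) \<in> borel_measurable M" "AE \<omega> in M. W \<omega> = B *v Z \<omega>"
    and A: "A \<in> sets F"
    and sq: "\<And>j. integrable M (\<lambda>\<omega>. indicator A \<omega> * (Z \<omega> $ j)\<^sup>2)"
    and bd: "\<And>\<omega> j. \<omega> \<in> A \<Longrightarrow> \<bar>real_cond_exp M F (\<lambda>\<omega>. Z \<omega> $ j) \<omega>\<bar> \<le> K"
  shows "AE \<omega> in M. \<omega> \<in> A \<longrightarrow> cond_cov M F W \<omega> = B ** cond_cov M F Z \<omega> ** transpose B"
proof -
  define m where "m j = real_cond_exp M F (\<lambda>\<omega>. Z \<omega> $ j)" for j
  define mW where "mW j = real_cond_exp M F (\<lambda>\<omega>. W \<omega> $ j)" for j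
  define D where "D j \<omega> = Z \<omega> $ j - m j \<omega>" for j \<omega>
  define DW where "DW j \<omega> = W \<omega> $ j - mW j \<omega>" for j \<omega>
  have [measurable]: "A \<in> sets M" using A subalg by (auto simp: subalgebra_def)
  have [measurable]: "m j \<in> borel_measurable M" "mW j \<in> borel_measurable M" for j
    by (simp_all add: m_def mW_def)
  note [measurable] = Z W(1)
  have [measurable]: "D j \<in> borel_measurable M" "DW j \<in> borel_measurable M" for j
    unfolding D_def DW_def by measurable
  have int1: "integrable M (\<lambda>\<omega>. indicator A \<omega> * Z \<omega> $ j)" for j
  proof (rule Bochner_Integration.integrable_bound)
    show "integrable M (\<lambda>\<omega>. 1 + indicator A \<omega> * (Z \<omega> $ j)\<^sup>2)" using sq by simp
    have "\<bar>a\<bar> \<le> 1 + a\<^sup>2" for a :: real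
      using sum_squares_bound[of "\<bar>a\<bar>" 1] by (cases "\<bar>a\<bar> \<le> 1") auto
    then show "AE \<omega> in M. norm (indicator A \<omega> * Z \<omega> $ j) \<le> norm (1 + indicator A \<omega> * (Z \<omega> $ j)\<^sup>2)"
      by (auto split: split_indicator)
  qed measurable
  have int2: "integrable M (\<lambda>\<omega>. indicator A \<omega> * (D j \<omega> * D l \<omega>))" for j l
  proof (rule Bochner_Integration.integrable_bound)
    \<comment> \<open>The dominating function comes from 2|ab| <= a^2 + b^2 together with (z - m)^2
      <= 2 z^2 + 2 m^2 and |m| <= \<open>K\<close>.\<close>
    show "integrable M (\<lambda>\<omega>. indicator A \<omega> * (Z \<omega> $ j)\<^sup>2 + indicator A \<omega> * (Z \<omega> $ l)\<^sup>2 + 2 * K\<^sup>2)"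
      using sq by simp
    show "AE \<omega> in M. norm (indicator A \<omega> * (D j \<omega> * D l \<omega>)) \<le>
        norm (indicator A \<omega> * (Z \<omega> $ j)\<^sup>2 + indicator A \<omega> * (Z \<omega> $ l)\<^sup>2 + 2 * K\<^sup>2)"
    proof (rule AE_I2)
      fix \<omega>
      show "norm (indicator A \<omega> * (D j \<omega> * D l \<omega>)) \<le>
        norm (indicator A \<omega> * (Z \<omega> $ j)\<^sup>2 + indicator A \<omega> * (Z \<omega> $ l)\<^sup>2 + 2 * K\<^sup>2)"
      proof (cases "\<omega> \<in> A")
        case True
        have sqD: "(D i \<omega>)\<^sup>2 \<le> 2 * (Z \<omega> $ i)\<^sup>2 + 2 * K\<^sup>2" for i
        proof -
          have "(m i \<omega>)\<^sup>2 \<le> K\<^sup>2" using power_mono[OF bd[OF True, of i], of 2] by (simp add: m_def)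
          moreover have "(D i \<omega>)\<^sup>2 \<le> 2 * (Z \<omega> $ i)\<^sup>2 + 2 * (m i \<omega>)\<^sup>2"
            using zero_le_power2[of "Z \<omega> $ i + m i \<omega>"]
            by (simp add: D_def power2_sum power2_diff)
          ultimately show ?thesis by linarith
        qed
        have "2 * \<bar>D j \<omega> * D l \<omega>\<bar> \<le> (D j \<omega>)\<^sup>2 + (D l \<omega>)\<^sup>2"
          using sum_squares_bound[of "\<bar>D j \<omega>\<bar>" "\<bar>D l \<omega>\<bar>"] by (simp add: abs_mult)
        then have "\<bar>D j \<omega> * D l \<omega>\<bar> \<le> (Z \<omega> $ j)\<^sup>2 + (Z \<omega> $ l)\<^sup>2 + 2 * K\<^sup>2"
          using sqD[of j] sqD[of l] by linarith
        then show ?thesis using True by simp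
      qed simp
    qed
  qed measurable
  have mean: "AE \<omega> in M. \<forall>i. \<omega> \<in> A \<longrightarrow> mW i \<omega> = (\<Sum>j\<in>UNIV. B $ i $ j * m j \<omega>)"
    unfolding mW_def m_def
  proof (subst AE_all_countable, intro allI real_cond_exp_local_linear A Z W int1)
    fix i show "AE \<omega> in M. \<omega> \<in> A \<longrightarrow> W \<omega> $ i = (\<Sum>j\<in>UNIV. B $ i $ j * Z \<omega> $ j)"
      using W(2) by eventually_elim (simp add: matrix_vector_mult_def)
  qed simp
  \<comment> \<open>Indexing by pairs turns the double sum into one linear combination, so the local
    linearity lemma applies.\<close>
  have "AE \<omega> in M. \<forall>i k. \<omega> \<in> A \<longrightarrow> real_cond_exp M F (\<lambda>\<omega>. DW i \<omega> * DW k \<omega>) \<omega> =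
    (\<Sum>p\<in>UNIV. (B $ i $ fst p * B $ k $ snd p) * real_cond_exp M F (\<lambda>\<omega>. D (fst p) \<omega> * D (snd p) \<omega>) \<omega>)"
  proof (simp only: AE_all_countable, intro allI real_cond_exp_local_linear A int2)
    fix i k
    show "AE \<omega> in M. \<omega> \<in> A \<longrightarrow> DW i \<omega> * DW k \<omega> =
      (\<Sum>p\<in>UNIV. (B $ i $ fst p * B $ k $ snd p) * (D (fst p) \<omega> * D (snd p) \<omega>))"
      using mean W(2)
    proof eventually_elim
      case (elim \<omega>)
      show ?case
      proof
        assume "\<omega> \<in> A"
        then have DW: "DW i \<omega> = (\<Sum>j\<in>UNIV. B $ i $ j * D j \<omega>)" for i
          using elim by (simp add: DW_def D_def matrix_vector_mult_def right_diff_distrib sum_subtractf)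
        have "DW i \<omega> * DW k \<omega> = (\<Sum>j\<in>UNIV. \<Sum>l\<in>UNIV. (B $ i $ j * B $ k $ l) * (D j \<omega> * D l \<omega>))"
          unfolding DW sum_product by (simp add: mult_ac)
        then show "DW i \<omega> * DW k \<omega> = (\<Sum>p\<in>UNIV. (B $ i $ fst p * B $ k $ snd p) * (D (fst p) \<omega> * D (snd p) \<omega>))"
          by (simp add: sum.cartesian_product case_prod_beta)
      qed
    qed
  qed measurable
  then show ?thesis
  proof eventually_elim
    case (elim \<omega>)
    show ?case
    proof
      assume A: "\<omega> \<in> A"
      have "cond_cov M F W \<omega> $ i $ k = (B ** cond_cov M F Z \<omega> ** transpose B) $ i $ k" for i k
      proof -
        have "cond_cov M F W \<omega> $ i $ k = real_cond_exp M F (\<lambda>\<omega>. DW i \<omega> * DW k \<omega>) \<omega>"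
          by (simp add: cond_cov_def DW_def mW_def)
        also have "\<dots> = (\<Sum>p\<in>UNIV. (B $ i $ fst p * B $ k $ snd p) * real_cond_exp M F (\<lambda>\<omega>. D (fst p) \<omega> * D (snd p) \<omega>) \<omega>)"
          using elim A by blast
        also have "\<dots> = (\<Sum>j\<in>UNIV. \<Sum>l\<in>UNIV. (B $ i $ j * B $ k $ l) * cond_cov M F Z \<omega> $ j $ l)"
          by (simp add: sum.cartesian_product case_prod_beta cond_cov_def D_def m_def)
        also have "\<dots> = (\<Sum>l\<in>UNIV. \<Sum>j\<in>UNIV. (B $ i $ j * B $ k $ l) * cond_cov M F Z \<omega> $ j $ l)"
          by (rule sum.swap)
        also have "\<dots> = (\<Sum>l\<in>UNIV. (\<Sum>j\<in>UNIV. B $ i $ j * cond_cov M F Z \<omega> $ j $ l) * B $ k $ l)"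
          unfolding sum_distrib_right by (intro sum.cong refl) (simp add: mult_ac)
        also have "\<dots> = (B ** cond_cov M F Z \<omega> ** transpose B) $ i $ k"
          by (simp add: matrix_matrix_mult_def transpose_def)
        finally show ?thesis .
      qed
      then show "cond_cov M F W \<omega> = B ** cond_cov M F Z \<omega> ** transpose B" by (simp add: vec_eq_iff)
    qed
  qed
qed

text \<open>
  Finiteness of the conditional second moments of \<open>Z\<close>: square integrability on each member of a
  countable \<open>F\<close>-measurable cover, without any unconditional moments.
\<close>

lemma cond_cov_linear_transform:
  fixes Z W :: "'a \<Rightarrow> real ^ 'd" and B :: "real ^ 'd ^ 'd" and A :: "nat \<Rightarrow> 'a set"
  assumes Z: "\<And>j. (\<lambda>\<omega>. Z \<omega> $ j) \<in> borel_measurable M"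
    and A: "\<And>N. A N \<in> sets F" "space M \<subseteq> (\<Union>N. A N)"
    and sq: "\<And>N j. integrable M (\<lambda>\<omega>. indicator (A N) \<omega> * (Z \<omega> $ j)\<^sup>2)"
    and W: "\<And>j. (\<lambda>\<omega>. W \<omega> $ j) \<in> borel_measurable M" "AE \<omega> in M. W \<omega> = B *v Z \<omega>"
  shows "AE \<omega> in M. cond_cov M F W \<omega> = B ** cond_cov M F Z \<omega> ** transpose B"
proof -
  define m where "m j = real_cond_exp M F (\<lambda>\<omega>. Z \<omega> $ j)" for j
  have mF [measurable]: "m j \<in> borel_measurable F" for j by (simp add: m_def)
  \<comment> \<open>The conditional means are real valued and \<open>F\<close>-measurable, so
    cutting each \<open>A N\<close> down to where they are at most \<open>K\<close> still covers the
    space as \<open>K\<close> grows.\<close>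
  define G where "G N K = A N \<inter> {\<omega>\<in>space F. \<forall>j. \<bar>m j \<omega>\<bar> \<le> real K}" for N K :: nat
  have G: "G N K \<in> sets F" for N K
  proof -
    have "{\<omega>\<in>space F. \<forall>j\<in>UNIV. \<bar>m j \<omega>\<bar> \<le> real K} \<in> sets F"
      by (intro sets.sets_Collect_finite_All borel_measurable_le borel_measurable_abs borel_measurable_const mF) simp
    then show ?thesis unfolding G_def using A(1) by simp
  qed
  have GM: "G N K \<in> sets M" for N K using G subalg by (auto simp: subalgebra_def)
  have "AE \<omega> in M. \<omega> \<in> G N K \<longrightarrow> cond_cov M F W \<omega> = B ** cond_cov M F Z \<omega> ** transpose B" for N K
  proof (rule cond_cov_linear_transform_on[OF Z W G])
    fix j
    have "integrable M (\<lambda>\<omega>. (indicator (A N) \<omega> * (Z \<omega> $ j)\<^sup>2) * indicator (G N K) \<omega>)"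
      by (intro integrable_real_mult_indicator GM sq)
    moreover have "(indicator (A N) \<omega> * (Z \<omega> $ j)\<^sup>2) * indicator (G N K) \<omega> = indicator (G N K) \<omega> * (Z \<omega> $ j)\<^sup>2" for \<omega>
      by (auto simp: G_def split: split_indicator)
    ultimately show "integrable M (\<lambda>\<omega>. indicator (G N K) \<omega> * (Z \<omega> $ j)\<^sup>2)" by simp
  next
    fix \<omega> j assume "\<omega> \<in> G N K"
    then show "\<bar>real_cond_exp M F (\<lambda>\<omega>. Z \<omega> $ j) \<omega>\<bar> \<le> real K" by (simp add: G_def m_def)
  qed
  then have "AE \<omega> in M. \<forall>N K. \<omega> \<in> G N K \<longrightarrow> cond_cov M F W \<omega> = B ** cond_cov M F Z \<omega> ** transpose B"
    by (simp only: AE_all_countable simp_thms)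
  with AE_space show ?thesis
  proof eventually_elim
    case (elim \<omega>)
    obtain N where N: "\<omega> \<in> A N" using A(2) elim(1) by blast
    obtain K :: nat where K: "Max (range (\<lambda>j. \<bar>m j \<omega>\<bar>)) \<le> real K" using real_arch_simple by blast
    have "\<bar>m j \<omega>\<bar> \<le> real K" for j
      by (rule order_trans[OF Max_ge K]) auto
    moreover have "\<omega> \<in> space F" using elim(1) subalg by (simp add: subalgebra_def)
    ultimately have "\<omega> \<in> G N K" using N by (simp add: G_def)
    with elim(2) show ?case by blast
  qed
qed

text \<open>The quadratic form at \<open>v\<close> is the conditional variance of the scalar
  \<open>inner v Z\<close>, a conditional expectation of a square.\<close>

lemma cond_cov_positive_semidefinite:
  fixes Z :: "'a \<Rightarrow> real ^ 'd" and A :: "nat \<Rightarrow> 'a set"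
  assumes Z: "\<And>j. (\<lambda>\<omega>. Z \<omega> $ j) \<in> borel_measurable M"
    and A: "\<And>N. A N \<in> sets F" "space M \<subseteq> (\<Union>N. A N)"
    and sq: "\<And>N j. integrable M (\<lambda>\<omega>. indicator (A N) \<omega> * (Z \<omega> $ j)\<^sup>2)"
  shows "AE \<omega> in M. \<forall>v. 0 \<le> inner v (cond_cov M F Z \<omega> *v v)"
proof -
  note [measurable] = Z
  \<comment> \<open>The null set depends on \<open>v\<close>; a countable dense set of vectors makes it uniform.\<close>
  have fixed: "AE \<omega> in M. 0 \<le> inner v (cond_cov M F Z \<omega> *v v)" for v
  proof -
    \<comment> \<open>Every row is \<open>v\<close>, so all components of \<open>W\<close> equal the
      scalar \<open>inner v Z\<close> and all diagonal entries of the congruence equal the quadratic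
      form; hence the arbitrary index \<open>undefined\<close>.\<close>
    define B :: "real ^ 'd ^ 'd" where "B = (\<chi> i j. v $ j)"
    define W where "W \<omega> = B *v Z \<omega>" for \<omega>
    have W [measurable]: "(\<lambda>\<omega>. W \<omega> $ j) \<in> borel_measurable M" for j
      unfolding W_def matrix_vector_mult_def vec_lambda_beta
      by (intro borel_measurable_sum borel_measurable_times borel_measurable_const Z)
    have "AE \<omega> in M. cond_cov M F W \<omega> = B ** cond_cov M F Z \<omega> ** transpose B"
      by (rule cond_cov_linear_transform[OF Z A sq W]) (simp_all add: W_def)
    moreover have "AE \<omega> in M. 0 \<le> cond_cov M F W \<omega> $ undefined $ undefined"
      unfolding cond_cov_def vec_lambda_beta
      by (rule real_cond_exp_pos) auto
    ultimately show ?thesis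
    proof eventually_elim
      case (elim \<omega>)
      have "(B ** C ** transpose B) $ i $ i = inner v (C *v v)" for C i
      proof -
        have "(B ** C ** transpose B) $ i $ i = (\<Sum>l\<in>UNIV. \<Sum>j\<in>UNIV. v $ j * C $ j $ l * v $ l)"
          by (simp add: B_def matrix_matrix_mult_def transpose_def sum_distrib_right)
        also have "\<dots> = inner v (C *v v)"
          by (subst sum.swap) (simp add: inner_vec_def matrix_vector_mult_def sum_distrib_left mult_ac)
        finally show ?thesis .
      qed
      with elim show ?case by metis
    qed
  qed
  obtain K :: "(real ^ 'd) set" where K: "countable K" "\<And>X. open X \<Longrightarrow> X \<noteq> {} \<Longrightarrow> \<exists>d\<in>K. d \<in> X"
    using countable_dense_exists by blast
  have dense: "closure K = UNIV"
  proof -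
    have "open (- closure K)" using closed_closure by (rule open_Compl)
    then show ?thesis using K(2)[of "- closure K"] closure_subset[of K] by blast
  qed
  have "AE \<omega> in M. \<forall>v\<in>K. 0 \<le> inner v (cond_cov M F Z \<omega> *v v)"
    using K(1) fixed by (simp add: AE_ball_countable)
  then show ?thesis
  proof eventually_elim
    case (elim \<omega>)
    have "closed {v. 0 \<le> inner v (cond_cov M F Z \<omega> *v v)}"
      by (intro closed_Collect_le continuous_intros linear_continuous_on
          linear_conv_bounded_linear[THEN iffD1] matrix_vector_mul_linear)
    then have "closure K \<subseteq> {v. 0 \<le> inner v (cond_cov M F Z \<omega> *v v)}"
      using elim by (intro closure_minimal) auto
    then show ?case using dense by auto
  qed
qed

end

lemma transpose_cond_cov: "transpose (cond_cov M F Z \<omega>) = cond_cov M F Z \<omega>"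
  by (simp add: transpose_def cond_cov_def vec_eq_iff mult.commute)

section \<open>Projection onto the support space\<close>

text \<open>Each point off the support has a basic neighbourhood of measure zero, and second
  countability leaves only countably many of these to unite.\<close>

lemma AE_law_support:
  fixes \<mu> :: "'a::second_countable_topology measure"
  assumes \<mu>: "sets \<mu> = sets borel"
  shows "AE f in \<mu>. f \<in> law_support \<mu>"
proof -
  obtain B :: "'a set set" where B: "countable B" "topological_basis B" using ex_countable_basis by blast
  define N where "N = \<Union>{U\<in>B. emeasure \<mu> U = 0}"
  have "N \<in> null_sets \<mu>"
  proof -
    have "(\<Union>U\<in>{U\<in>B. emeasure \<mu> U = 0}. U) \<in> null_sets \<mu>"
    proof (rule null_sets_UN')
      show "countable {U \<in> B. emeasure \<mu> U = 0}" using B(1) by (rule countable_subset[rotated]) auto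
      show "\<And>U. U \<in> {U \<in> B. emeasure \<mu> U = 0} \<Longrightarrow> U \<in> null_sets \<mu>"
        using topological_basis_open[OF B(2)] by (auto intro!: null_setsI simp: \<mu>)
    qed
    then show ?thesis by (simp add: N_def)
  qed
  moreover have "- law_support \<mu> \<subseteq> N"
  proof
    fix f assume "f \<in> - law_support \<mu>"
    then obtain U where U: "open U" "f \<in> U" "emeasure \<mu> U = 0"
      by (auto simp: law_support_def)
    obtain V where V: "V \<in> B" "f \<in> V" "V \<subseteq> U" using topological_basisE[OF B(2) U(1,2)] by metis
    have "emeasure \<mu> V \<le> emeasure \<mu> U" using V(3) U(1) by (intro emeasure_mono) (auto simp: \<mu>)
    then have "emeasure \<mu> V = 0" using U(3) by simp
    then show "f \<in> N" using V by (auto simp: N_def)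
  qed
  ultimately show ?thesis by (intro AE_I'[of N]) auto
qed

lemma closed_support_space:
  "subspace (closed_support_space M X)" "closed (closed_support_space M X)"
  "law_support (distr M borel X) \<subseteq> closed_support_space M X"
proof -
  have "subspace (closed_support_space M X) \<and> closed (closed_support_space M X)"
    unfolding closed_support_space_def
    by (rule hull_in) (auto intro: subspace_Inter)
  then show "subspace (closed_support_space M X)" "closed (closed_support_space M X)" by auto
  show "law_support (distr M borel X) \<subseteq> closed_support_space M X"
    unfolding closed_support_space_def by (rule hull_subset)
qed

lemma AE_closed_support_space:
  assumes "x \<in> borel_measurable M" "distr M borel x = distr M borel X"
  shows "AE \<omega> in M. x \<omega> \<in> closed_support_space M X"
proof -
  have "AE f in distr M borel X. f \<in> closed_support_space M X"
    using AE_law_support[of "distr M borel X"] closed_support_space(3)[of M X] by (auto elim: eventually_mono)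
  then have "AE f in distr M borel x. f \<in> closed_support_space M X" by (simp only: assms(2))
  moreover have "closed_support_space M X \<in> sets borel" by (intro borel_closed closed_support_space)
  ultimately show ?thesis
    by (subst (asm) AE_distr_iff[OF assms(1)]) auto
qed

lemma orth_proj:
  fixes V :: "'a::{real_inner, complete_space} set"
  assumes V: "subspace V" "closed V"
  shows "orth_proj V f \<in> V" "s \<in> V \<Longrightarrow> inner (f - orth_proj V f) s = 0"
proof -
  obtain p where p: "p \<in> V" "\<forall>v\<in>V. inner (f - p) v = 0"
    using closed_subspace_projection_exists[OF V] by blast
  have "orth_proj V f \<in> V \<and> (\<forall>s\<in>V. orthogonal (f - orth_proj V f) s)"
    unfolding orth_proj_def
  proof (rule theI[of _ p])
    show "p \<in> V \<and> (\<forall>s\<in>V. orthogonal (f - p) s)" using p by (simp add: orthogonal_def)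
    fix q assume q: "q \<in> V \<and> (\<forall>s\<in>V. orthogonal (f - q) s)"
    then have "q - p \<in> V" using V(1) p(1) by (simp add: subspace_diff)
    then have "inner (f - p) (q - p) - inner (f - q) (q - p) = 0" using p(2) q by (simp add: orthogonal_def)
    then have "inner (q - p) (q - p) = 0" by (simp add: inner_diff_left)
    then show "q = p" by simp
  qed
  then show "orth_proj V f \<in> V" "s \<in> V \<Longrightarrow> inner (f - orth_proj V f) s = 0"
    by (auto simp: orthogonal_def)
qed

section \<open>The matrix of the projection from \<open>D\<close> onto its image\<close>

context
  fixes S D :: "l2 set" and \<phi>D \<phi>E :: "'d::finite \<Rightarrow> l2"
  assumes S: "subspace S" "closed S"
    and bases: "orthonormal_basis \<phi>D D" "orthonormal_basis \<phi>E (orth_proj S ` D)"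
begin

text \<open>Each \<open>\<phi>E j\<close> lies in \<open>S\<close> and so does not see the part of
  \<open>\<phi>D k\<close> orthogonal to \<open>S\<close>. This identifies the matrix of inner
  products as the matrix of the projection.\<close>

lemma orth_proj_basis_expansion:
  "orth_proj S (\<phi>D k) = (\<Sum>j\<in>UNIV. projection_matrix \<phi>E \<phi>D $ j $ k *\<^sub>R \<phi>E j)"
proof -
  have "\<phi>D k \<in> D" using bases(1) by (auto simp: orthonormal_basis_def intro: span_base)
  then have *: "orth_proj S (\<phi>D k) = (\<Sum>j\<in>UNIV. inner (\<phi>E j) (orth_proj S (\<phi>D k)) *\<^sub>R \<phi>E j)"
    by (intro orthonormal_basis_expansion[OF bases(2)]) auto
  have "inner (\<phi>E j) (orth_proj S (\<phi>D k)) = inner (\<phi>E j) (\<phi>D k)" for j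
  proof -
    have "\<phi>E j \<in> orth_proj S ` D"
      using bases(2) span_base[of "\<phi>E j" "range \<phi>E"] by (simp add: orthonormal_basis_def)
    then have "\<phi>E j \<in> S" using orth_proj(1)[OF S] by auto
    from orth_proj(2)[OF S this, of "\<phi>D k"] show ?thesis
      unfolding inner_diff_left by (simp add: inner_commute)
  qed
  with * show ?thesis by (simp add: projection_matrix_def)
qed

lemma inner_basis_eq_projection_matrix:
  assumes "s \<in> S"
  shows "inner s (\<phi>D k) = (\<Sum>j\<in>UNIV. projection_matrix \<phi>E \<phi>D $ j $ k * inner s (\<phi>E j))"
proof -
  have "inner s (\<phi>D k) = inner s (orth_proj S (\<phi>D k))"
    using orth_proj(2)[OF S assms, of "\<phi>D k"]
    unfolding inner_diff_left by (simp add: inner_commute)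
  then show ?thesis by (simp add: orth_proj_basis_expansion inner_sum_right)
qed

text \<open>Translates coordinates into geometry: \<open>p\<close> is the orthogonal projection of
  \<open>b\<close> onto \<open>S\<close>, and both coordinate maps preserve norms. Contraction,
  isometry and invertibility are read off from it.\<close>

lemma projection_matrix_combination:
  fixes c :: "real ^ 'd"
  defines "b \<equiv> \<Sum>k\<in>UNIV. c $ k *\<^sub>R \<phi>D k"
    and "p \<equiv> \<Sum>j\<in>UNIV. (projection_matrix \<phi>E \<phi>D *v c) $ j *\<^sub>R \<phi>E j"
  shows "b \<in> D" "p \<in> S" "\<And>s. s \<in> S \<Longrightarrow> inner (b - p) s = 0"
    "norm b = norm c" "norm p = norm (projection_matrix \<phi>E \<phi>D *v c)"
proof -
  show "b \<in> D" unfolding b_def by (rule orthonormal_basis_combination_mem[OF bases(1)])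
  show "norm b = norm c" "norm p = norm (projection_matrix \<phi>E \<phi>D *v c)"
    unfolding b_def p_def by (rule orthonormal_basis_norm[OF bases(1)] orthonormal_basis_norm[OF bases(2)])+
  have p: "p = (\<Sum>k\<in>UNIV. c $ k *\<^sub>R orth_proj S (\<phi>D k))"
  proof -
    have "p = (\<Sum>j\<in>UNIV. \<Sum>k\<in>UNIV. (c $ k * projection_matrix \<phi>E \<phi>D $ j $ k) *\<^sub>R \<phi>E j)"
      by (simp add: p_def matrix_vector_mult_def scaleR_sum_left mult.commute)
    also have "\<dots> = (\<Sum>k\<in>UNIV. c $ k *\<^sub>R orth_proj S (\<phi>D k))"
      by (subst sum.swap) (simp add: orth_proj_basis_expansion scaleR_sum_right)
    finally show ?thesis .
  qed
  then show "p \<in> S" using S(1) orth_proj(1)[OF S] by (auto intro!: subspace_sum subspace_scale)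
  have "b - p = (\<Sum>k\<in>UNIV. c $ k *\<^sub>R (\<phi>D k - orth_proj S (\<phi>D k)))"
    by (simp add: b_def p scaleR_diff_right sum_subtractf)
  then show "inner (b - p) s = 0" if "s \<in> S" for s
    using orth_proj(2)[OF S that] by (simp add: inner_sum_left)
qed

lemma projection_matrix_contraction: "norm (projection_matrix \<phi>E \<phi>D *v c) \<le> norm c"
proof -
  let ?b = "\<Sum>k\<in>UNIV. c $ k *\<^sub>R \<phi>D k" and ?p = "\<Sum>j\<in>UNIV. (projection_matrix \<phi>E \<phi>D *v c) $ j *\<^sub>R \<phi>E j"
  note c = projection_matrix_combination[where c = c]
  have "inner ?b ?p = inner ?p ?p" using c(3)[OF c(2)] by (simp add: inner_diff_left)
  then have "norm ?p * norm ?p \<le> norm ?b * norm ?p"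
    using norm_cauchy_schwarz[of ?b ?p] by (simp add: power2_norm_eq_inner flip: power2_eq_square)
  then have "norm ?p \<le> norm ?b" by (cases "norm ?p = 0") (auto simp: mult_le_cancel_right)
  then show ?thesis by (simp add: c(4,5))
qed

lemma projection_matrix_isometry:
  assumes "D \<subseteq> S"
  shows "norm (projection_matrix \<phi>E \<phi>D *v c) = norm c"
proof -
  let ?b = "\<Sum>k\<in>UNIV. c $ k *\<^sub>R \<phi>D k" and ?p = "\<Sum>j\<in>UNIV. (projection_matrix \<phi>E \<phi>D *v c) $ j *\<^sub>R \<phi>E j"
  note c = projection_matrix_combination[where c = c]
  have "?b - ?p \<in> S" using assms c(1,2) S(1) by (auto intro: subspace_diff)
  then have "?b = ?p" using c(3)[of "?b - ?p"] by simp
  then show ?thesis using c(4,5) by simp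
qed

lemma projection_matrix_invertible:
  assumes "D \<inter> orthogonal_comp S \<subseteq> {0}"
  shows "invertible (projection_matrix \<phi>E \<phi>D)"
proof -
  have "c = 0" if "projection_matrix \<phi>E \<phi>D *v c = 0" for c
  proof -
    let ?b = "\<Sum>k\<in>UNIV. c $ k *\<^sub>R \<phi>D k"
    note c = projection_matrix_combination[where c = c]
    have "inner ?b s = 0" if "s \<in> S" for s
      using c(3)[OF that] \<open>projection_matrix \<phi>E \<phi>D *v c = 0\<close> by simp
    then have "?b \<in> orthogonal_comp S"
      by (simp add: orthogonal_comp_def orthogonal_def inner_commute)
    then have "?b = 0" using assms c(1) by blast
    then show "c = 0" using c(4) by simp
  qed
  then show ?thesis
    by (metis invertible_left_inverse matrix_left_invertible_ker)
qed

end

section \<open>Moments of the estimators\<close>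

lemma space_sigma_generated [simp]: "space (sigma_generated M n Z) = space M"
  by (simp add: sigma_generated_def)

lemma subalgebra_sigma_generated:
  assumes "\<And>i. i \<in> {1..n} \<Longrightarrow> Z i \<in> borel_measurable M"
  shows "subalgebra M (sigma_generated M n Z)"
  unfolding subalgebra_def
proof
  show "sets (sigma_generated M n Z) \<subseteq> sets M"
    unfolding sigma_generated_def
    by (rule sets_image_in_sets) (auto intro!: measurable_restrict assms)
qed simp

lemma measurable_sigma_generated:
  assumes i: "i \<in> {1..n}"
  shows "Z i \<in> borel_measurable (sigma_generated M n Z)"
proof -
  have "(\<lambda>\<omega>. \<lambda>i\<in>{1..n}. Z i \<omega>) \<in> measurable (sigma_generated M n Z) (PiM {1..n} (\<lambda>_. borel))"
    unfolding sigma_generated_def by (rule measurable_vimage_algebra1) (auto simp: space_PiM)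
  from measurable_compose[OF this measurable_component_singleton[OF i]]
  show ?thesis using i by simp
qed

section \<open>Local square integrability of the estimators\<close>

lemma integrable_square_sum:
  fixes f :: "'i \<Rightarrow> 'a \<Rightarrow> real"
  assumes f: "\<And>i. i \<in> I \<Longrightarrow> f i \<in> borel_measurable M" "\<And>i. i \<in> I \<Longrightarrow> integrable M (\<lambda>x. (f i x)\<^sup>2)"
  shows "integrable M (\<lambda>x. (\<Sum>i\<in>I. f i x)\<^sup>2)"
proof (rule Bochner_Integration.integrable_bound)
  show "integrable M (\<lambda>x. (\<Sum>i\<in>I. (f i x)\<^sup>2) * real (card I))"
    using f(2) by auto
  show "(\<lambda>x. (\<Sum>i\<in>I. f i x)\<^sup>2) \<in> borel_measurable M" using f(1) by measurable
  show "AE x in M. norm ((\<Sum>i\<in>I. f i x)\<^sup>2) \<le> norm ((\<Sum>i\<in>I. (f i x)\<^sup>2) * real (card I))"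
    by (intro AE_I2) (simp add: sum_nonneg sum_squared_le_sum_of_squares)
qed

text \<open>Weights and signal are functions of the design, so the events where all of them are at
  most \<open>N\<close> belong to \<open>F\<close> and exhaust the space. On such an event only the
  errors remain unbounded, and these are square integrable.\<close>

lemma lse_coords_locally_square_integrable:
  fixes \<phi> :: "'d::finite \<Rightarrow> l2"
  assumes \<phi>: "orthonormal_basis \<phi> V" and FM: "subalgebra M F" and fin: "finite_measure M"
    and x: "\<And>i. i \<in> {1..n} \<Longrightarrow> x i \<in> borel_measurable F"
    and \<epsilon>: "\<And>i. i \<in> {1..n} \<Longrightarrow> \<epsilon> i \<in> borel_measurable M"
      "\<And>i. i \<in> {1..n} \<Longrightarrow> integrable M (\<lambda>\<omega>. (\<epsilon> i \<omega>)\<^sup>2)"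
    and y: "\<And>i \<omega>. i \<in> {1..n} \<Longrightarrow> \<omega> \<in> space M \<Longrightarrow> y i \<omega> = inner (x i \<omega>) \<beta> + \<epsilon> i \<omega>"
  defines "Z \<equiv> \<lambda>\<omega>. lse_coords n (\<lambda>i. x i \<omega>) (\<lambda>i. y i \<omega>) V \<phi>"
  shows "(\<lambda>\<omega>. Z \<omega> $ j) \<in> borel_measurable M"
    "\<exists>A. (\<forall>N. A N \<in> sets F) \<and> space M \<subseteq> (\<Union>N::nat. A N) \<and>
      (\<forall>N j. integrable M (\<lambda>\<omega>. indicator (A N) \<omega> * (Z \<omega> $ j)\<^sup>2))"
proof -
  interpret finite_measure M by fact
  define w where "w j i \<omega> = lse_weight n (\<lambda>i. x i \<omega>) \<phi> j i" for j i \<omega>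
  define a where "a i \<omega> = inner (x i \<omega>) \<beta>" for i \<omega>
  have wF: "w j i \<in> borel_measurable F" if "i \<in> {1..n}" for j i
    unfolding w_def by (rule borel_measurable_lse_weight[OF x that])
  have aF: "a i \<in> borel_measurable F" if "i \<in> {1..n}" for i
    unfolding a_def using x[OF that] by measurable
  note wM = measurable_from_subalg[OF FM wF] and aM = measurable_from_subalg[OF FM aF]
  have Z: "Z \<omega> $ j = (\<Sum>i=1..n. w j i \<omega> * (a i \<omega> + \<epsilon> i \<omega>))" if "\<omega> \<in> space M" for \<omega> j
    using y that by (simp add: Z_def w_def a_def lse_coords_eq_weighted_sum[OF \<phi>])
  have Zm: "(\<lambda>\<omega>. Z \<omega> $ j) \<in> borel_measurable M" for j
    by (subst measurable_cong[OF Z])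
      (auto intro!: borel_measurable_sum borel_measurable_times borel_measurable_add wM aM \<epsilon>(1))
  then show "(\<lambda>\<omega>. Z \<omega> $ j) \<in> borel_measurable M" .
  define A where "A N = {\<omega> \<in> space F. \<forall>i\<in>{1..n}. \<bar>a i \<omega>\<bar> \<le> real N \<and> (\<forall>j\<in>UNIV. \<bar>w j i \<omega>\<bar> \<le> real N)}" for N
  have AF: "A N \<in> sets F" for N
  proof -
    have "{\<omega> \<in> space F. \<bar>a i \<omega>\<bar> \<le> real N} \<in> sets F" if "i \<in> {1..n}" for i
      using aF[OF that] by measurable
    moreover have "{\<omega> \<in> space F. \<bar>w j i \<omega>\<bar> \<le> real N} \<in> sets F" if "i \<in> {1..n}" for i j
      using wF[OF that] by measurable
    ultimately show ?thesis
      unfolding A_def by (intro sets.sets_Collect_finite_All sets.sets_Collect_conj) auto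
  qed
  have AM: "A N \<in> sets M" for N using AF FM by (auto simp: subalgebra_def)
  have cover: "space M \<subseteq> (\<Union>N. A N)"
  proof
    fix \<omega> assume "\<omega> \<in> space M"
    obtain N :: nat where N: "(\<Sum>i=1..n. \<bar>a i \<omega>\<bar> + (\<Sum>j\<in>UNIV. \<bar>w j i \<omega>\<bar>)) \<le> real N"
      using real_arch_simple by blast
    have "\<bar>a i \<omega>\<bar> \<le> real N \<and> \<bar>w j i \<omega>\<bar> \<le> real N" if i: "i \<in> {1..n}" for i j
    proof -
      let ?h = "\<lambda>i. \<bar>a i \<omega>\<bar> + (\<Sum>j\<in>UNIV. \<bar>w j i \<omega>\<bar>)"
      have w0: "0 \<le> (\<Sum>j\<in>UNIV. \<bar>w j i \<omega>\<bar>)" for i by (rule sum_nonneg) simp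
      have "?h i \<le> sum ?h {1..n}"
        by (rule member_le_sum[OF i]) (use w0 in \<open>simp_all add: add_nonneg_nonneg\<close>)
      moreover have "\<bar>w j i \<omega>\<bar> \<le> (\<Sum>j\<in>UNIV. \<bar>w j i \<omega>\<bar>)"
        by (rule member_le_sum) auto
      ultimately show ?thesis using N w0[of i] by linarith
    qed
    then have "\<omega> \<in> A N"
      using FM \<open>\<omega> \<in> space M\<close> by (simp add: A_def subalgebra_def)
    then show "\<omega> \<in> (\<Union>N. A N)" by blast
  qed
  have "integrable M (\<lambda>\<omega>. indicator (A N) \<omega> * (Z \<omega> $ j)\<^sup>2)" for N j
  proof -
    let ?f = "\<lambda>i \<omega>. indicator (A N) \<omega> * (w j i \<omega> * (a i \<omega> + \<epsilon> i \<omega>))"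
    have fm: "?f i \<in> borel_measurable M" if "i \<in> {1..n}" for i
      using AM wM[OF that] aM[OF that] \<epsilon>(1)[OF that] by measurable
    have "integrable M (\<lambda>\<omega>. (\<Sum>i=1..n. ?f i \<omega>)\<^sup>2)"
    proof (rule integrable_square_sum[OF fm])
      fix i assume i: "i \<in> {1..n}"
      show "integrable M (\<lambda>\<omega>. (?f i \<omega>)\<^sup>2)"
      proof (rule Bochner_Integration.integrable_bound)
        show "integrable M (\<lambda>\<omega>. (real N)\<^sup>2 * (2 * (real N)\<^sup>2 + 2 * (\<epsilon> i \<omega>)\<^sup>2))"
          using \<epsilon>(2)[OF i] by simp
        show "(\<lambda>\<omega>. (?f i \<omega>)\<^sup>2) \<in> borel_measurable M" using fm[OF i] by measurable
        show "AE \<omega> in M. norm ((?f i \<omega>)\<^sup>2) \<le> norm ((real N)\<^sup>2 * (2 * (real N)\<^sup>2 + 2 * (\<epsilon> i \<omega>)\<^sup>2))"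
        proof (rule AE_I2)
          fix \<omega>
          show "norm ((?f i \<omega>)\<^sup>2) \<le> norm ((real N)\<^sup>2 * (2 * (real N)\<^sup>2 + 2 * (\<epsilon> i \<omega>)\<^sup>2))"
          proof (cases "\<omega> \<in> A N")
            case True
            then have "\<bar>a i \<omega>\<bar> \<le> real N" "\<bar>w j i \<omega>\<bar> \<le> real N" using i by (auto simp: A_def)
            then have 1: "(a i \<omega>)\<^sup>2 \<le> (real N)\<^sup>2" "(w j i \<omega>)\<^sup>2 \<le> (real N)\<^sup>2"
              by (simp_all add: abs_le_square_iff[symmetric])
            have "(a i \<omega> + \<epsilon> i \<omega>)\<^sup>2 \<le> 2 * (a i \<omega>)\<^sup>2 + 2 * (\<epsilon> i \<omega>)\<^sup>2"
              using zero_le_power2[of "a i \<omega> - \<epsilon> i \<omega>"] by (simp add: power2_sum power2_diff)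
            with 1(1) have "(a i \<omega> + \<epsilon> i \<omega>)\<^sup>2 \<le> 2 * (real N)\<^sup>2 + 2 * (\<epsilon> i \<omega>)\<^sup>2" by linarith
            from mult_mono[OF 1(2) this] True show ?thesis by (simp add: power_mult_distrib)
          qed simp
        qed
      qed
    qed
    moreover have "integrable M (\<lambda>\<omega>. (\<Sum>i=1..n. ?f i \<omega>)\<^sup>2) \<longleftrightarrow>
        integrable M (\<lambda>\<omega>. indicator (A N) \<omega> * (Z \<omega> $ j)\<^sup>2)"
    proof (rule Bochner_Integration.integrable_cong)
      fix \<omega> assume "\<omega> \<in> space M"
      then show "(\<Sum>i=1..n. ?f i \<omega>)\<^sup>2 = indicator (A N) \<omega> * (Z \<omega> $ j)\<^sup>2"
        unfolding sum_distrib_left[symmetric] by (simp add: Z split: split_indicator)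
    qed simp
    ultimately show ?thesis by blast
  qed
  with AF cover show "\<exists>A. (\<forall>N. A N \<in> sets F) \<and> space M \<subseteq> (\<Union>N::nat. A N) \<and>
      (\<forall>N j. integrable M (\<lambda>\<omega>. indicator (A N) \<omega> * (Z \<omega> $ j)\<^sup>2))"
    by blast
qed

theorem mainTheorem3:
  fixes T :: "real set" and M :: "'w measure" and X :: "'w \<Rightarrow> l2"
    and n :: nat and x :: "nat \<Rightarrow> 'w \<Rightarrow> l2" and \<epsilon> y :: "nat \<Rightarrow> 'w \<Rightarrow> real"
    and \<beta> :: l2 and \<sigma> :: real
    and S D E :: "l2 set" and \<phi>D \<phi>E :: "'d::finite \<Rightarrow> l2" and P :: "real ^ 'd ^ 'd"
    and F :: "'w measure" and \<beta>D \<beta>E :: "'w \<Rightarrow> real ^ 'd"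
  assumes T: "compact T" and M: "prob_space M"
    and X: "X \<in> borel_measurable M" "\<forall>\<omega>\<in>space M. X \<omega> \<in> L2_on T"
      "integrable M (\<lambda>\<omega>. (norm (X \<omega>))\<^sup>2)" "(LINT \<omega>|M. X \<omega>) = 0"
    and x: "\<forall>i\<in>{1..n}. \<forall>\<omega>\<in>space M. x i \<omega> \<in> L2_on T"
      "prob_space.indep_vars M (\<lambda>_. borel) x {1..n}"
      "\<forall>i\<in>{1..n}. distr M borel (x i) = distr M borel X"
    and \<epsilon>: "prob_space.indep_vars M (\<lambda>_. borel) \<epsilon> {1..n}"
      "\<forall>i\<in>{1..n}. integrable M (\<lambda>\<omega>. (\<epsilon> i \<omega>)\<^sup>2)"
      "\<forall>i\<in>{1..n}. (LINT \<omega>|M. \<epsilon> i \<omega>) = 0"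
      "\<forall>i\<in>{1..n}. (LINT \<omega>|M. (\<epsilon> i \<omega> - (LINT \<omega>|M. \<epsilon> i \<omega>))\<^sup>2) = \<sigma>\<^sup>2"
      "\<sigma>\<^sup>2 > 0"
    and x_\<epsilon>: "prob_space.indep_set M (sets (sigma_generated M n x)) (sets (sigma_generated M n \<epsilon>))"
    and \<beta>: "\<beta> \<in> L2_on T"
    and y: "\<forall>i\<in>{1..n}. \<forall>\<omega>\<in>space M. y i \<omega> = inner (x i \<omega>) \<beta> + \<epsilon> i \<omega>"
    and S: "S = closed_support_space M X"
    and D: "subspace D" "D \<subseteq> L2_on T" "identifiable T S D" "dim D = CARD('d)"
    and E: "E = orth_proj S ` D"
    and bases: "orthonormal_basis \<phi>D D" "orthonormal_basis \<phi>E E"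
    and P: "P = projection_matrix \<phi>E \<phi>D"
    and F: "F = sigma_generated M n x"
    and \<beta>D: "\<beta>D = (\<lambda>\<omega>. lse_coords n (\<lambda>i. x i \<omega>) (\<lambda>i. y i \<omega>) D \<phi>D)"
    and \<beta>E: "\<beta>E = (\<lambda>\<omega>. lse_coords n (\<lambda>i. x i \<omega>) (\<lambda>i. y i \<omega>) E \<phi>E)"
  shows "invertible P \<and>
    (AE \<omega> in M.
      lse_uniquely_defined n (\<lambda>i. x i \<omega>) D \<and> lse_uniquely_defined n (\<lambda>i. x i \<omega>) E \<longrightarrow>
      cond_cov M F \<beta>D \<omega> =
        matrix_inv P ** cond_cov M F \<beta>E \<omega> ** transpose (matrix_inv P) \<and>
      (\<forall>\<nu>D \<nu>E.
        ordered_eigenvalues (cond_cov M F \<beta>D \<omega>) \<nu>D \<and>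
        ordered_eigenvalues (cond_cov M F \<beta>E \<omega>) \<nu>E \<longrightarrow>
        (\<forall>k\<in>{1..CARD('d)}. \<nu>D k \<ge> \<nu>E k) \<and>
        (D \<subseteq> S \<longrightarrow> (\<forall>k\<in>{1..CARD('d)}. \<nu>D k = \<nu>E k)) \<and>
        (\<forall>\<epsilon>D>0. (\<forall>\<mu>. eigenvalue (transpose P ** P) \<mu> \<longrightarrow> \<mu> > \<epsilon>D) \<longrightarrow>
          (\<forall>k\<in>{1..CARD('d)}. \<nu>D k \<le> 1 / \<epsilon>D * \<nu>E k))))"
proof -
  interpret prob_space M by (rule M)
  have xM: "x i \<in> borel_measurable M" if "i \<in> {1..n}" for i
    using x(2) that by (auto simp: indep_vars_def)
  have \<epsilon>M: "\<epsilon> i \<in> borel_measurable M" if "i \<in> {1..n}" for i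
    using \<epsilon>(1) that by (auto simp: indep_vars_def)
  have FM: "subalgebra M F" unfolding F by (rule subalgebra_sigma_generated[OF xM])
  have xF: "x i \<in> borel_measurable F" if "i \<in> {1..n}" for i
    unfolding F by (rule measurable_sigma_generated[OF that])
  interpret finite_measure_subalgebra M F by unfold_locales (rule FM)
  have S': "subspace S" "closed S" unfolding S by (rule closed_support_space)+
  note bases' = bases(1) bases(2)[unfolded E]
  have P_invertible: "invertible P"
    \<comment> \<open>As \<open>D\<close> lies in \<open>L2_on T\<close>, taking the complement
      inside \<open>L2_on T\<close> in \<open>identifiable\<close> does not change the intersection
      with \<open>D\<close>.\<close>
    unfolding P using D(2,3) by (intro projection_matrix_invertible[OF S' bases']) (auto simp: identifiable_def)
  have P_contraction: "(norm (P *v v))\<^sup>2 \<le> 1 * (norm v)\<^sup>2" for v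
    unfolding P using projection_matrix_contraction[OF S' bases'] by (simp add: power_mono)
  define Q where "Q = matrix_inv P"
  have "P ** Q = mat 1 \<and> Q ** P = mat 1"
    using P_invertible unfolding Q_def matrix_inv_def invertible_def by (rule someI_ex)
  then have PQ: "P ** Q = mat 1" and QP: "Q ** P = mat 1" by auto
  have Q_invertible: "invertible Q" using PQ QP by (auto simp: invertible_def)
  have PQv: "P *v (Q *v v) = v" and QPv: "Q *v (P *v v) = v" for v
    by (simp_all add: matrix_vector_mul_assoc PQ QP)
  have "AE \<omega> in M. \<forall>i\<in>{1..n}. x i \<omega> \<in> S"
    unfolding S using x(3) by (intro AE_finite_allI AE_closed_support_space xM) auto
  then have \<beta>_eq: "AE \<omega> in M. \<beta>D \<omega> = Q *v \<beta>E \<omega>"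
  proof eventually_elim
    case (elim \<omega>)
    have "\<beta>E \<omega> = P *v \<beta>D \<omega>"
      unfolding \<beta>D \<beta>E using elim inner_basis_eq_projection_matrix[OF S' bases']
      by (intro lse_coords_change_of_basis[OF bases P_invertible]) (auto simp: P)
    then show ?case by (simp add: QPv)
  qed
  have y': "y i \<omega> = inner (x i \<omega>) \<beta> + \<epsilon> i \<omega>" if "i \<in> {1..n}" "\<omega> \<in> space M" for i \<omega>
    using y that by blast
  have \<epsilon>2: "integrable M (\<lambda>\<omega>. (\<epsilon> i \<omega>)\<^sup>2)" if "i \<in> {1..n}" for i
    using \<epsilon>(2) that by blast
  note loc = lse_coords_locally_square_integrable[OF _ FM finite_measure_axioms xF \<epsilon>M \<epsilon>2 y']
  have \<beta>DM: "(\<lambda>\<omega>. \<beta>D \<omega> $ j) \<in> borel_measurable M" for j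
    unfolding \<beta>D by (rule loc(1)[OF bases(1)])
  have \<beta>EM: "(\<lambda>\<omega>. \<beta>E \<omega> $ j) \<in> borel_measurable M" for j
    unfolding \<beta>E by (rule loc(1)[OF bases(2)])
  have "\<exists>A. (\<forall>N. A N \<in> sets F) \<and> space M \<subseteq> (\<Union>N::nat. A N) \<and>
      (\<forall>N j. integrable M (\<lambda>\<omega>. indicator (A N) \<omega> * (\<beta>E \<omega> $ j)\<^sup>2))"
    unfolding \<beta>E by (rule loc(2)[OF bases(2)])
  then obtain A :: "nat \<Rightarrow> 'w set" where A: "\<And>N. A N \<in> sets F" "space M \<subseteq> (\<Union>N. A N)"
      "\<And>N j. integrable M (\<lambda>\<omega>. indicator (A N) \<omega> * (\<beta>E \<omega> $ j)\<^sup>2)"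
    by blast
  note cov = cond_cov_linear_transform[OF \<beta>EM A \<beta>DM \<beta>_eq]
  note psd = cond_cov_positive_semidefinite[OF \<beta>EM A]
  show ?thesis
  proof (intro conjI P_invertible)
    show "AE \<omega> in M.
      lse_uniquely_defined n (\<lambda>i. x i \<omega>) D \<and> lse_uniquely_defined n (\<lambda>i. x i \<omega>) E \<longrightarrow>
      cond_cov M F \<beta>D \<omega> =
        matrix_inv P ** cond_cov M F \<beta>E \<omega> ** transpose (matrix_inv P) \<and>
      (\<forall>\<nu>D \<nu>E.
        ordered_eigenvalues (cond_cov M F \<beta>D \<omega>) \<nu>D \<and>
        ordered_eigenvalues (cond_cov M F \<beta>E \<omega>) \<nu>E \<longrightarrow>
        (\<forall>k\<in>{1..CARD('d)}. \<nu>D k \<ge> \<nu>E k) \<and>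
        (D \<subseteq> S \<longrightarrow> (\<forall>k\<in>{1..CARD('d)}. \<nu>D k = \<nu>E k)) \<and>
        (\<forall>\<epsilon>D>0. (\<forall>\<mu>. eigenvalue (transpose P ** P) \<mu> \<longrightarrow> \<mu> > \<epsilon>D) \<longrightarrow>
          (\<forall>k\<in>{1..CARD('d)}. \<nu>D k \<le> 1 / \<epsilon>D * \<nu>E k)))"
      using cov psd
    proof eventually_elim
      case (elim \<omega>)
      let ?CD = "cond_cov M F \<beta>D \<omega>" and ?CE = "cond_cov M F \<beta>E \<omega>"
      have psdE: "0 \<le> inner v (?CE *v v)" for v using elim(2) by blast
      \<comment> \<open>Semidefiniteness passes through the congruence; it is needed since (i) uses
        the covariance for \<open>D\<close> as the reference matrix.\<close>
      have psdD: "0 \<le> inner v (?CD *v v)" for v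
      proof -
        have "inner v (?CD *v v) = inner v (Q *v (?CE *v (transpose Q *v v)))"
          unfolding elim(1) by (simp only: matrix_vector_mul_assoc matrix_mul_assoc)
        also have "\<dots> = inner (transpose Q *v v) (?CE *v (transpose Q *v v))"
          by (simp add: dot_lmul_matrix)
        finally show ?thesis using psdE by simp
      qed
      have "P ** ?CD ** transpose P = (P ** Q) ** ?CE ** (transpose Q ** transpose P)"
        unfolding elim(1) by (simp only: matrix_mul_assoc)
      then have CE: "P ** ?CD ** transpose P = ?CE"
        by (simp add: PQ flip: matrix_transpose_mul)
      show ?case
        unfolding Q_def[symmetric]
      proof (intro impI conjI allI elim(1))
        fix \<nu>D \<nu>E assume \<nu>: "ordered_eigenvalues ?CD \<nu>D \<and> ordered_eigenvalues ?CE \<nu>E"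
        have \<nu>D: "ordered_eigenvalues ?CD \<nu>D" and \<nu>E: "ordered_eigenvalues ?CE \<nu>E"
          using \<nu> by auto
        \<comment> \<open>The reference matrix is \<open>?CE\<close> here, with \<open>?CD\<close>
          its congruence by \<open>Q\<close>; in \<open>ge\<close> the roles are exchanged and the
          congruence is by \<open>P\<close>.\<close>
        have bound: "\<nu>D k \<le> c * \<nu>E k"
          if Qc: "\<And>v. (norm (Q *v v))\<^sup>2 \<le> c * (norm v)\<^sup>2" and k: "k \<in> {1..CARD('d)}" for c k
          by (rule ordered_eigenvalues_congruence_le[OF transpose_cond_cov psdE Q_invertible
                norm_transpose_le[OF Qc] \<nu>E \<nu>D[unfolded elim(1)] k])
        have ge: "\<nu>E k \<le> 1 * \<nu>D k" if "k \<in> {1..CARD('d)}" for k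
          by (rule ordered_eigenvalues_congruence_le[OF transpose_cond_cov psdD P_invertible
                norm_transpose_le[OF P_contraction] \<nu>D \<nu>E[folded CE] that])
        show "\<forall>k\<in>{1..CARD('d)}. \<nu>D k \<ge> \<nu>E k" using ge by simp
        show "\<forall>k\<in>{1..CARD('d)}. \<nu>D k = \<nu>E k" if "D \<subseteq> S"
        proof
          fix k assume k: "k \<in> {1..CARD('d)}"
          have "norm (Q *v v) = norm v" for v
            using projection_matrix_isometry[OF S' bases' that, of "Q *v v"] by (simp add: P[symmetric] PQv)
          then have "\<nu>D k \<le> 1 * \<nu>E k" using k by (intro bound) auto
          with ge[OF k] show "\<nu>D k = \<nu>E k" by simp
        qed
        fix e :: real assume e: "0 < e" and eig: "\<forall>\<mu>. eigenvalue (transpose P ** P) \<mu> \<longrightarrow> e < \<mu>"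
        \<comment> \<open>The lower bound on \<open>P\<close> is evaluated at \<open>Q *v v\<close>,
          where \<open>P\<close> returns \<open>v\<close>.\<close>
        have "(norm (Q *v v))\<^sup>2 \<le> 1 / e * (norm v)\<^sup>2" for v
          using eigenvalue_gt_imp_norm_ge[of P e "Q *v v"] eig e by (simp add: PQv field_simps)
        then show "\<forall>k\<in>{1..CARD('d)}. \<nu>D k \<le> 1 / e * \<nu>E k" using bound by blast
      qed
    qed
  qed
qed

end
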